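(* Let $H$ be a complex Hilbert space and let $T\in\mathcal{B}(H)$ satisfy $\sigma_{ess}(T^*T)=\sigma_{ess}(TT^* )$. Then: (1) $TT^*\in\mathcal{AM}(H)$ if and only if $T^*T\in\mathcal{AM}(H)$. (2) $T\in\mathcal{AM}(H)$ if and only if $T^*\in\mathcal{AM}(H)$.
   Context: $\mathcal{B}(H)$ is the space of bounded linear operators on $H$. A bounded operator $S:H_1\to H_2$ between Hilbert spaces is minimum attaining if there is a unit vector $x\in H_1$ with $\|Sx\|=m(S)$, where $m(S)=\inf\{\|Sx\|:x\in H_1,\ \|x\|=1\}$. $T\in\mathcal{B}(H)$ is absolutely minimum attaining, written $T\in\mathcal{AM}(H)$, if for every nonzero closed subspace $M\subseteq H$ the restriction $T|_M:M\to H$ is minimum attaining. For self-adjoint $A\in\mathcal{B}(H)$, the discrete spectrum $\sigma_d(A)$ is the set of isolated points of $\sigma(A)$ that are eigenvalues of finite multiplicity, and $\sigma_{ess}(A)=\sigma(A)\setminus\sigma_d(A)$. *)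

theory Defs
  imports "HOL-Analysis.Analysis"
begin

section \<open>Complex Hilbert spaces\<close>

class scaleC =
  fixes scaleC :: "complex \<Rightarrow> 'a \<Rightarrow> 'a"  (infixr \<open>*\<^sub>C\<close> 75)

class complex_vector = real_vector + scaleC +
  assumes scaleC_add_right: "a *\<^sub>C (x + y) = a *\<^sub>C x + a *\<^sub>C y"
    and scaleC_add_left: "(a + b) *\<^sub>C x = a *\<^sub>C x + b *\<^sub>C x"
    and scaleC_scaleC: "a *\<^sub>C (b *\<^sub>C x) = (a * b) *\<^sub>C x"
    and scaleC_one: "1 *\<^sub>C x = x"
    and scaleR_scaleC: "r *\<^sub>R x = complex_of_real r *\<^sub>C x"

global_interpretation complex_vector: vector_space
    "scaleC :: complex \<Rightarrow> 'a \<Rightarrow> 'a :: complex_vector"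
  defines csubspace = complex_vector.subspace
    and cspan = complex_vector.span
  by unfold_locales
    (simp_all add: scaleC_add_right scaleC_add_left scaleC_scaleC scaleC_one)

text \<open>
  The complex inner product is linear in the second argument.  The topology and the norm come from
  \<^class>\<open>real_inner\<close>, whose inner product is required to be the real part of the complex one; so
  \<open>norm x\<close> is the square root of \<open>cinner x x\<close> (see \<open>cinner_self\<close>), and definiteness is inherited.
\<close>

class complex_inner = complex_vector + real_inner +
  fixes cinner :: "'a \<Rightarrow> 'a \<Rightarrow> complex"
  assumes cinner_commute: "cinner x y = cnj (cinner y x)"
    and cinner_add_right: "cinner x (y + z) = cinner x y + cinner x z"
    and cinner_scaleC_right: "cinner x (c *\<^sub>C y) = c * cinner x y"
    and inner_eq_Re_cinner: "inner x y = Re (cinner x y)"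

class chilbert_space = complex_inner + complete_space

lemma cinner_self: "cinner x x = complex_of_real ((norm x)\<^sup>2)"
  for x :: "'a::complex_inner"
proof -
  have "Im (cinner x x) = 0"
    using arg_cong[OF cinner_commute[of x x], of Im] by simp
  then show ?thesis
    by (simp add: complex_eq_iff power2_norm_eq_inner inner_eq_Re_cinner)
qed

instantiation complex :: chilbert_space
begin
definition scaleC_complex :: "complex \<Rightarrow> complex \<Rightarrow> complex"
  where "scaleC_complex c z = c * z"
definition cinner_complex :: "complex \<Rightarrow> complex \<Rightarrow> complex"
  where "cinner_complex x y = cnj x * y"
instance
  by standard
    (simp_all add: scaleC_complex_def cinner_complex_def algebra_simps inner_complex_def
      scaleR_conv_of_real)
end

section \<open>Bounded operators and the Hilbert space adjoint\<close>

definition bounded_clinear :: "('a::complex_inner \<Rightarrow> 'b::complex_inner) \<Rightarrow> bool"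
  where "bounded_clinear T \<longleftrightarrow> bounded_linear T \<and> (\<forall>c x. T (c *\<^sub>C x) = c *\<^sub>C T x)"

text \<open>
  For a bounded operator on a Hilbert space the adjoint exists by the Riesz representation theorem,
  and it is unique because \<^const>\<open>cinner\<close> is definite, so the description below is proper.
\<close>

definition cadjoint :: "('a::complex_inner \<Rightarrow> 'b::complex_inner) \<Rightarrow> 'b \<Rightarrow> 'a"
  where "cadjoint T = (THE S. \<forall>x y. cinner (T x) y = cinner x (S y))"

section \<open>Spectrum, discrete spectrum and essential spectrum\<close>

definition spectrum :: "('a::complex_inner \<Rightarrow> 'a) \<Rightarrow> complex set"
  where "spectrum A =
    {l. \<not> (\<exists>S. bounded_clinear S \<and>
              (\<lambda>x. A x - l *\<^sub>C x) \<circ> S = id \<and> S \<circ> (\<lambda>x. A x - l *\<^sub>C x) = id)}"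

definition eigenspace :: "('a::complex_inner \<Rightarrow> 'a) \<Rightarrow> complex \<Rightarrow> 'a set"
  where "eigenspace A l = {x. A x = l *\<^sub>C x}"

definition eigenvalue_of_finite_multiplicity :: "('a::complex_inner \<Rightarrow> 'a) \<Rightarrow> complex \<Rightarrow> bool"
  where "eigenvalue_of_finite_multiplicity A l \<longleftrightarrow>
    eigenspace A l \<noteq> {0} \<and> (\<exists>B. finite B \<and> cspan B = eigenspace A l)"

text \<open>
  The following two notions are intended for self-adjoint operators only, for which geometric and
  algebraic multiplicity agree.
\<close>

definition discrete_spectrum :: "('a::complex_inner \<Rightarrow> 'a) \<Rightarrow> complex set"
  where "discrete_spectrum A =
    {l. l isolated_in spectrum A \<and> eigenvalue_of_finite_multiplicity A l}"

definition essential_spectrum :: "('a::complex_inner \<Rightarrow> 'a) \<Rightarrow> complex set"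
  where "essential_spectrum A = spectrum A - discrete_spectrum A"

section \<open>Minimum attaining and absolutely minimum attaining operators\<close>

text \<open>
  Since a closed subspace \<open>M\<close> is not a type, the notions for the restriction of \<open>S\<close> to \<open>M\<close> are
  expressed relative to the set \<open>M\<close>; an operator on the whole space is the case \<open>M = UNIV\<close>.
  The infimum is only meaningful for \<open>M \<noteq> {0}\<close>.
\<close>

definition minimum_modulus_on :: "'a::complex_inner set \<Rightarrow> ('a \<Rightarrow> 'b::complex_inner) \<Rightarrow> real"
  where "minimum_modulus_on M S = Inf {norm (S x) |x. x \<in> M \<and> norm x = 1}"

definition minimum_attaining_on :: "'a::complex_inner set \<Rightarrow> ('a \<Rightarrow> 'b::complex_inner) \<Rightarrow> bool"
  where "minimum_attaining_on M S \<longleftrightarrow>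
    (\<exists>x\<in>M. norm x = 1 \<and> norm (S x) = minimum_modulus_on M S)"

definition absolutely_minimum_attaining :: "('a::complex_inner \<Rightarrow> 'b::complex_inner) \<Rightarrow> bool"
  where "absolutely_minimum_attaining T \<longleftrightarrow>
    bounded_clinear T \<and>
    (\<forall>M. csubspace M \<and> closed M \<and> M \<noteq> {0} \<longrightarrow> minimum_attaining_on M T)"

end

theory Submission
  imports Defs
begin

text \<open>
  The property of being absolutely minimum attaining depends only on how \<open>\<parallel>T x\<parallel>\<^sup>2\<close>
  behaves on subspaces of finite codimension.  Call \<open>a\<close> an essential lower (upper) bound if
  \<open>a \<parallel>x\<parallel>\<^sup>2\<close> bounds \<open>\<parallel>T x\<parallel>\<^sup>2\<close> from below (above) on some closed subspace of
  finite codimension.  The operator is pinched if some essential upper bound \<open>c\<close> is such that all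
  \<open>a < c\<close> are essential lower bounds.  Then \<open>T\<close> is absolutely minimum attaining if and only if it is
  pinched.  If \<open>T\<close> is pinched and \<open>M\<close> is a closed subspace, a minimizing sequence in \<open>M\<close> has a
  convergent subsequence when its limit value lies below \<open>c\<close>, and \<open>c\<close> itself is attained for trivial
  reasons (\<open>pinched_imp_absolutely_minimum_attaining\<close>).  If \<open>T\<close> is not pinched, an orthonormal
  sequence with orthogonal images along which \<open>\<parallel>T x\<parallel>\<^sup>2\<close> tends to a value from
  strictly above has a closed span without a minimizer (\<open>absolutely_minimum_attaining_imp_pinched\<close>).

  It remains to compare the pinching of \<open>T\<close>, \<open>T\<^sup>*\<close>, \<open>T\<^sup>* T\<close> and \<open>T T\<^sup>*\<close>.
  Upper bounds pass between them by the Cauchy--Schwarz inequality.  For lower bounds, the least point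
  of the essential spectrum has approximate eigenvectors in every subspace of finite codimension
  (\<open>weyl_vector\<close>).  This gives that \<open>T\<close> is pinched if and only if \<open>T\<^sup>* T\<close> is, and so
  reduces part (1) to part (2).  It also lets \<open>T\<^sup>*\<close> carry approximate eigenvectors of
  \<open>T T\<^sup>*\<close> to approximate eigenvectors of \<open>T\<^sup>* T\<close> for the same value, as long as this
  value is not \<open>0\<close> (\<open>pinched_adjoint\<close>).

  So the two essential spectra can only differ at \<open>0\<close>, and this is where their equality is used.  The
  point \<open>0\<close> lies outside the essential spectrum of \<open>T\<^sup>* T\<close> if and only if \<open>T\<close> has a positive
  essential lower bound (\<open>zero_notin_essential_spectrum\<close>,
  \<open>essentially_ge_if_zero_notin_essential_spectrum\<close>).  The spectral theorem is replaced throughout by a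
  variational estimate, \<open>gradient_bound\<close>: near the infimum of a quadratic form its gradient is small.
\<close>

section \<open>The complex inner product\<close>

lemma cinner_add_left: "cinner (x + y) z = cinner x z + cinner y z"
  for x y z :: "'a::complex_inner"
  by (subst (1 2 3) cinner_commute) (simp add: cinner_add_right)

lemma cinner_scaleC_left: "cinner (c *\<^sub>C x) y = cnj c * cinner x y"
  for x y :: "'a::complex_inner"
  by (subst (1 2) cinner_commute) (simp add: cinner_scaleC_right)

lemma norm_scaleC: "norm (c *\<^sub>C x) = cmod c * norm x"
  for x :: "'a::complex_inner"
proof -
  have "cinner (c *\<^sub>C x) (c *\<^sub>C x) = complex_of_real ((cmod c)\<^sup>2 * (norm x)\<^sup>2)"
    unfolding of_real_mult complex_norm_square cinner_self[symmetric]
    by (simp add: cinner_scaleC_left cinner_scaleC_right)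
  then have "(norm (c *\<^sub>C x))\<^sup>2 = (cmod c * norm x)\<^sup>2"
    unfolding cinner_self of_real_eq_iff by (simp add: power_mult_distrib)
  then show ?thesis by (simp add: power2_eq_iff_nonneg)
qed

lemma norm_cinner_le: "cmod (cinner x y) \<le> norm x * norm y"
  for x y :: "'a::complex_inner"
proof -
  define c where "c = cinner x y"
  have "inner (c *\<^sub>C x) y = (cmod c)\<^sup>2"
    by (simp add: inner_eq_Re_cinner cinner_scaleC_left c_def[symmetric] cmod_power2)
      (simp add: power2_eq_square)
  then have "cmod c * cmod c \<le> cmod c * (norm x * norm y)"
    using norm_cauchy_schwarz[of "c *\<^sub>C x" y] by (simp add: norm_scaleC power2_eq_square mult.assoc)
  then show ?thesis unfolding c_def[symmetric]
    by (cases "c = 0") auto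
qed

lemma bounded_linear_cinner_right: "bounded_linear (cinner x)"
  for x :: "'a::complex_inner"
  by (rule bounded_linear_intro[where K = "norm x"])
    (simp_all add: cinner_add_right scaleR_scaleC cinner_scaleC_right scaleC_complex_def
      norm_cinner_le mult.commute[of _ "norm x"])

lemma bounded_linear_cinner_left: "bounded_linear (\<lambda>x. cinner x y)"
  for y :: "'a::complex_inner"
  by (rule bounded_linear_intro[where K = "norm y"])
    (simp_all add: cinner_add_left scaleR_scaleC cinner_scaleC_left scaleC_complex_def
      norm_cinner_le)

lemmas cinner_diff_right = linear_diff[OF bounded_linear.linear[OF bounded_linear_cinner_right]]
lemmas cinner_diff_left = linear_diff[OF bounded_linear.linear[OF bounded_linear_cinner_left]]
lemmas cinner_zero_right [simp] = linear_0[OF bounded_linear.linear[OF bounded_linear_cinner_right]]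
lemmas cinner_zero_left [simp] = linear_0[OF bounded_linear.linear[OF bounded_linear_cinner_left]]

lemma cinner_eq_0_commute: "cinner x y = 0 \<longleftrightarrow> cinner y x = 0"
  for x y :: "'a::complex_inner"
  by (metis cinner_commute complex_cnj_zero)

lemma cinner_eqI: "x = y" if "\<And>z. cinner z x = cinner z y"
  for x y :: "'a::complex_inner"
proof -
  have "cinner (x - y) (x - y) = 0" using that[of "x - y"] by (simp only: cinner_diff_right) simp
  then show ?thesis by (simp add: cinner_self)
qed

lemma csubspace_imp_subspace: "subspace M" if "csubspace M"
  for M :: "'a::complex_inner set"
  using that unfolding subspace_def complex_vector.subspace_def by (auto simp: scaleR_scaleC)

text \<open>
  A complex subspace contains \<open>\<i> m\<close> with every \<open>m\<close>, and testing against \<open>\<i> m\<close> detects the imaginary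
  part.  So orthogonality may be established for the real inner product, where the projection theorem
  and the Riesz representation below live.
\<close>

lemma cinner_eq_0_if_inner:
  fixes M :: "'a::complex_inner set"
  assumes "csubspace M" "\<And>m. m \<in> M \<Longrightarrow> inner m x = 0" "m \<in> M"
  shows "cinner m x = 0"
proof -
  have "\<i> *\<^sub>C m \<in> M" using assms complex_vector.subspace_scale by blast
  then have "inner (\<i> *\<^sub>C m) x = 0" "inner m x = 0" using assms by auto
  then show ?thesis
    by (simp add: inner_eq_Re_cinner cinner_scaleC_left complex_eq_iff)
qed

section \<open>Projections, the Riesz representation and adjoints\<close>

text \<open>
  A sequence in \<open>M\<close> whose distance to \<open>x\<close> tends to the infimum is Cauchy by the parallelogram law, and
  at a nearest point \<open>q\<close> the first variation of the squared distance in every direction of \<open>M\<close>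
  vanishes.
\<close>

lemma closed_subspace_projection:
  fixes M :: "'a::{real_inner,complete_space} set"
  assumes "closed M" "subspace M"
  obtains p where "p \<in> M" "\<And>m. m \<in> M \<Longrightarrow> inner m (x - p) = 0"
proof -
  have ne: "M \<noteq> {}" using subspace_0[OF \<open>subspace M\<close>] by auto
  define d where "d = infdist x M"
  have d0: "d \<ge> 0" unfolding d_def by (rule infdist_nonneg)
  have lower: "d \<le> norm (x - m)" if "m \<in> M" for m
    using infdist_le[OF that, of x] by (simp add: d_def dist_norm)
  have "\<exists>p\<in>M. norm (x - p) < d + 1 / real (Suc n)" for n
  proof -
    have "(INF m\<in>M. dist x m) < d + 1 / real (Suc n)"
      using ne by (simp add: d_def infdist_notempty)
    then show ?thesis using ne by (subst (asm) cINF_less_iff) (auto simp: dist_norm intro!: bdd_belowI2[of _ 0])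
  qed
  then obtain p where p: "\<And>n. p n \<in> M" "\<And>n. norm (x - p n) < d + 1 / real (Suc n)"
    by metis
  have lim: "(\<lambda>n. norm (x - p n)) \<longlonglongrightarrow> d"
  proof (rule tendsto_sandwich[of "\<lambda>_. d" _ _ "\<lambda>n. d + 1 / real (Suc n)"])
    show "(\<lambda>n. d + 1 / real (Suc n)) \<longlonglongrightarrow> d"
      using tendsto_add[OF tendsto_const[of d] LIMSEQ_Suc[OF lim_1_over_n]] by simp
  qed (use lower p in \<open>auto intro!: always_eventually less_imp_le\<close>)
  have par: "(dist (p k) (p l))\<^sup>2 \<le> 2 * ((norm (x - p k))\<^sup>2 - d\<^sup>2) + 2 * ((norm (x - p l))\<^sup>2 - d\<^sup>2)" for k l
  proof -
    define h where "h = (1/2) *\<^sub>R (p k + p l)"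
    have "h \<in> M" unfolding h_def using p assms by (simp add: subspace_add subspace_scale)
    then have "d\<^sup>2 \<le> (norm (x - h))\<^sup>2" using lower d0 by (simp add: power_mono)
    moreover have "(norm (p k - p l))\<^sup>2 + 4 * (norm (x - h))\<^sup>2
        = 2 * (norm (x - p k))\<^sup>2 + 2 * (norm (x - p l))\<^sup>2"
      unfolding h_def power2_norm_eq_inner
      by (simp add: algebra_simps inner_commute)
    ultimately show ?thesis by (simp add: dist_norm)
  qed
  have "Cauchy p"
  proof (rule metric_CauchyI)
    fix e :: real assume "e > 0"
    have "(\<lambda>n. (norm (x - p n))\<^sup>2) \<longlonglongrightarrow> d\<^sup>2" by (intro tendsto_intros lim)
    then have "\<forall>\<^sub>F n in sequentially. (norm (x - p n))\<^sup>2 < d\<^sup>2 + e\<^sup>2 / 4"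
      using \<open>e > 0\<close> by (intro order_tendstoD) auto
    then obtain N where N: "\<And>n. n \<ge> N \<Longrightarrow> (norm (x - p n))\<^sup>2 < d\<^sup>2 + e\<^sup>2 / 4"
      unfolding eventually_sequentially by blast
    have "dist (p k) (p l) < e" if "k \<ge> N" "l \<ge> N" for k l
      using par[of k l] N[OF that(1)] N[OF that(2)] \<open>e > 0\<close>
      by (intro power_less_imp_less_base[of _ 2 e]) auto
    then show "\<exists>N. \<forall>k\<ge>N. \<forall>l\<ge>N. dist (p k) (p l) < e" by blast
  qed
  then obtain q where q: "p \<longlonglongrightarrow> q" using Cauchy_convergent convergent_def by blast
  have qM: "q \<in> M" using closed_sequentially[OF assms(1)] p q by blast
  have "(\<lambda>n. norm (x - p n)) \<longlonglongrightarrow> norm (x - q)" by (intro tendsto_intros q)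
  then have qd: "norm (x - q) = d" using lim LIMSEQ_unique by blast
  have "inner m (x - q) = 0" if "m \<in> M" for m
  proof (cases "m = 0")
    case False
    \<comment> \<open>This step length minimizes the distance to \<open>x\<close> along the line \<open>q + t m\<close>.\<close>
    define t where "t = inner m (x - q) / inner m m"
    have "q + t *\<^sub>R m \<in> M" using qM that assms by (simp add: subspace_add subspace_scale)
    then have "(norm (x - q))\<^sup>2 \<le> (norm (x - (q + t *\<^sub>R m)))\<^sup>2" using lower qd d0 by (simp add: power_mono)
    also have "(norm (x - (q + t *\<^sub>R m)))\<^sup>2 = (norm (x - q))\<^sup>2 - 2 * t * inner m (x - q) + t * t * inner m m"
      unfolding power2_norm_eq_inner by (simp add: algebra_simps inner_commute)
    also have "\<dots> = (norm (x - q))\<^sup>2 - (inner m (x - q))\<^sup>2 / inner m m"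
      using False by (simp add: t_def field_simps power2_eq_square)
    finally have "(inner m (x - q))\<^sup>2 / inner m m \<le> 0" by simp
    moreover have "inner m m > 0" using False by simp
    ultimately show ?thesis using False by (auto simp: divide_le_0_iff not_le)
  qed simp
  then show ?thesis using that qM by blast
qed

lemma csubspace_projection:
  fixes M :: "'a::chilbert_space set"
  assumes "closed M" "csubspace M"
  obtains p where "p \<in> M" "\<And>m. m \<in> M \<Longrightarrow> cinner m (x - p) = 0"
proof -
  obtain p where "p \<in> M" "\<And>m. m \<in> M \<Longrightarrow> inner m (x - p) = 0"
    using closed_subspace_projection[OF assms(1) csubspace_imp_subspace[OF assms(2)]] by blast
  then show ?thesis using that cinner_eq_0_if_inner[OF assms(2)] by blast
qed

text \<open>
  If the functional is not zero, a vector orthogonal to its kernel represents it up to a scalar factor.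
\<close>

lemma riesz_representation:
  fixes f :: "'a::{real_inner,complete_space} \<Rightarrow> real"
  assumes "bounded_linear f"
  shows "\<exists>z. \<forall>x. f x = inner z x"
proof (cases "\<forall>x. f x = 0")
  case True then show ?thesis by (intro exI[of _ 0]) auto
next
  case False
  then obtain w where w: "f w \<noteq> 0" by blast
  interpret f: bounded_linear f by fact
  define M where "M = {x. f x = 0}"
  have "M = f -` {0}" unfolding M_def by auto
  then have "closed M" 
    by (auto intro!: continuous_closed_vimage linear_continuous_at assms)
  moreover have "subspace M" unfolding M_def subspace_def by (simp add: f.add f.scaleR f.zero)
  ultimately obtain p where p: "p \<in> M" "\<And>m. m \<in> M \<Longrightarrow> inner m (w - p) = 0"
    using closed_subspace_projection by blast
  define u where "u = w - p"
  have fu: "f u \<noteq> 0" using w p(1) by (simp add: u_def M_def f.diff)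
  then have u: "inner u u \<noteq> 0" using f.zero by auto
  have "f x = inner ((f u / inner u u) *\<^sub>R u) x" for x
  proof -
    have "x - (f x / f u) *\<^sub>R u \<in> M" using fu by (simp add: M_def f.diff f.scaleR)
    then have "inner (x - (f x / f u) *\<^sub>R u) u = 0" using p unfolding u_def by blast
    then have "inner x u = (f x / f u) * inner u u" by (simp add: inner_diff_left)
    then show ?thesis using fu u by (simp add: inner_commute)
  qed
  then show ?thesis by blast
qed

text \<open>
  Being adjoint to each other is a symmetric relation between \<open>T\<close> and \<open>S\<close>.  With it, every result on
  \<open>T\<close> and \<open>S \<circ> T\<close> applies verbatim to \<open>S\<close> and \<open>T \<circ> S\<close>.
\<close>

definition adjoint_pair :: "('a::complex_inner \<Rightarrow> 'b::complex_inner) \<Rightarrow> ('b \<Rightarrow> 'a) \<Rightarrow> bool"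
  where "adjoint_pair T S \<longleftrightarrow> bounded_clinear T \<and> bounded_clinear S \<and>
    (\<forall>x y. cinner (T x) y = cinner x (S y))"

lemma adjoint_pair_sym: "adjoint_pair S T" if "adjoint_pair T S"
  using that unfolding adjoint_pair_def by (metis cinner_commute)

lemma adjoint_pairD:
  assumes "adjoint_pair T S"
  shows "bounded_clinear T" "bounded_clinear S"
    "cinner (T x) y = cinner x (S y)" "cinner y (T x) = cinner (S y) x"
  using assms adjoint_pair_sym[OF assms] unfolding adjoint_pair_def by metis+

lemma bounded_clinearD:
  assumes "bounded_clinear T"
  shows "bounded_linear T" "T (x + y) = T x + T y" "T (x - y) = T x - T y" "T 0 = 0"
    "T (c *\<^sub>C x) = c *\<^sub>C T x" "T (r *\<^sub>R x) = r *\<^sub>R T x"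
  using assms linear_add linear_diff linear_0 linear_scale bounded_linear.linear
  unfolding bounded_clinear_def by metis+

lemma bounded_clinear_bound:
  assumes "bounded_clinear T"
  obtains K where "K > 0" "\<And>x. norm (T x) \<le> K * norm x"
  using bounded_linear.pos_bounded[OF bounded_clinearD(1)[OF assms]]
  by (auto simp: mult.commute)

lemma adjoint_pair_cadjoint:
  fixes T :: "'a::chilbert_space \<Rightarrow> 'b::complex_inner"
  assumes T: "bounded_clinear T"
  shows "adjoint_pair T (cadjoint T)"
proof -
  note Tl = bounded_clinearD[OF T]
  have "\<exists>z. \<forall>x. cinner (T x) y = cinner x z" for y
  proof -
    have "bounded_linear (\<lambda>x. inner y (T x))"
      using bounded_linear_compose[OF bounded_linear_inner_right Tl(1)] .
    then obtain z where z: "\<And>x. inner y (T x) = inner z x"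
      using riesz_representation by blast
    have "cinner (T x) y = cinner x z" for x
      \<comment> \<open>The representing vector is found for the real part; replacing \<open>x\<close> by \<open>\<i> x\<close> gives the
        imaginary part.\<close>
      using z[of x] z[of "\<i> *\<^sub>C x"] 
      by (simp add: inner_eq_Re_cinner Tl cinner_scaleC_right cinner_commute[of "T x"] cinner_commute[of x] complex_eq_iff)
    then show ?thesis by blast
  qed
  then obtain S where S: "\<And>x y. cinner (T x) y = cinner x (S y)" by metis
  have "cadjoint T = S" unfolding cadjoint_def
  proof (rule the_equality)
    show "\<forall>x y. cinner (T x) y = cinner x (S y)" using S by blast
    show "R = S" if "\<forall>x y. cinner (T x) y = cinner x (R y)" for R
      using that S by (metis (full_types) cinner_eqI ext)
  qed
  moreover have "bounded_clinear S"
  proof -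
    obtain K where K: "K > 0" "\<And>x. norm (T x) \<le> K * norm x" using bounded_clinear_bound[OF T] by blast
    have add: "S (x + y) = S x + S y" for x y
      by (rule cinner_eqI) (simp add: cinner_add_right S[symmetric])
    have sc: "S (c *\<^sub>C x) = c *\<^sub>C S x" for c x
      by (rule cinner_eqI) (simp add: cinner_scaleC_right S[symmetric])
    have "norm (S y) \<le> norm y * K" for y
    proof -
      have "(norm (S y))\<^sup>2 = cmod (cinner (S y) (S y))" by (simp only: cinner_self norm_of_real) simp
      also have "\<dots> = cmod (cinner (T (S y)) y)" by (simp add: S)
      also have "\<dots> \<le> norm (T (S y)) * norm y" by (rule norm_cinner_le)
      also have "\<dots> \<le> K * norm (S y) * norm y" using K by (simp add: mult_right_mono)
      finally have "norm (S y) * norm (S y) \<le> norm (S y) * (norm y * K)"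
        by (simp add: power2_eq_square ac_simps)
      then show ?thesis using K(1)
        by (metis mult_le_cancel_left_pos mult_nonneg_nonneg less_imp_le norm_ge_zero order_le_less)
    qed
    then show ?thesis unfolding bounded_clinear_def
      by (auto intro!: bounded_linear_intro simp: add sc scaleR_scaleC)
  qed
  ultimately show ?thesis using T S unfolding adjoint_pair_def by simp
qed

lemma bounded_clinear_comp:
  assumes "bounded_clinear S" "bounded_clinear T"
  shows "bounded_clinear (S \<circ> T)"
  using assms bounded_linear_compose unfolding bounded_clinear_def comp_def by auto

lemma adjoint_pair_comp:
  assumes "adjoint_pair T S"
  shows "adjoint_pair (S \<circ> T) (S \<circ> T)"
  using assms adjoint_pair_sym[OF assms] bounded_clinear_comp unfolding adjoint_pair_def by force

lemma adjoint_pair_quadratic_form: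
  assumes "adjoint_pair T S"
  shows "inner (S (T x)) y = inner (T x) (T y)"
    "(norm (T x))\<^sup>2 \<le> norm (S (T x)) * norm x"
proof -
  show 1: "inner (S (T x)) y = inner (T x) (T y)" for x y
    unfolding inner_eq_Re_cinner adjoint_pairD[OF assms] ..
  show "(norm (T x))\<^sup>2 \<le> norm (S (T x)) * norm x"
    using norm_cauchy_schwarz[of "S (T x)" x] unfolding power2_norm_eq_inner 1 .
qed

section \<open>Subspaces of finite codimension\<close>

text \<open>
  For finite \<open>B\<close> this is a closed subspace of finite codimension.  The set \<open>B\<close> may be arbitrary, so
  that intersecting two of them is a union of sets and pulling one back along an operator is an image
  under the adjoint.
\<close>

definition orth :: "'a::complex_inner set \<Rightarrow> 'a set"
  where "orth B = {x. \<forall>b\<in>B. cinner b x = 0}"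

lemma csubspace_orth: "csubspace (orth B)"
  unfolding orth_def complex_vector.subspace_def
  by (simp add: cinner_add_right cinner_scaleC_right)

lemma closed_orth: "closed (orth B)"
proof -
  have "orth B = (\<Inter>b\<in>B. {x. cinner b x = 0})" unfolding orth_def by auto
  moreover have "closed {x. cinner b x = 0}" for b :: 'a
    by (intro closed_Collect_eq continuous_on_const
        linear_continuous_on[OF bounded_linear_cinner_right])
  ultimately show ?thesis by auto
qed

lemma orth_Un: "orth (A \<union> B) = orth A \<inter> orth B"
  unfolding orth_def by auto

lemma mem_orth_image:
  assumes "adjoint_pair T S"
  shows "x \<in> orth (S ` B) \<longleftrightarrow> T x \<in> orth B"
  unfolding orth_def using adjoint_pairD[OF assms] by simp

text \<open>
  A vector that is almost orthogonal to a finite set is close to a vector that is orthogonal to it, and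
  the correction can be chosen inside a given subspace \<open>M\<close>.  In the induction, a new condition that does
  not follow from the old ones on \<open>M\<close> is enforced by subtracting a multiple of one fixed vector \<open>w\<close>.
\<close>

lemma approximate_in_orth:
  fixes B :: "'a::complex_inner set"
  assumes "finite B" "csubspace M"
  shows "\<exists>C\<ge>0. \<forall>y\<in>M. \<exists>v\<in>M \<inter> orth B. norm (y - v) \<le> C * (\<Sum>b\<in>B. cmod (cinner b y))"
  using assms(1)
proof induction
  case empty
  show ?case by (intro exI[of _ 0]) (auto simp: orth_def)
next
  case (insert b B)
  obtain C where C0: "C \<ge> 0 \<and> (\<forall>y\<in>M. \<exists>v\<in>M \<inter> orth B. norm (y - v) \<le> C * (\<Sum>b\<in>B. cmod (cinner b y)))"
    using insert.IH by (rule exE)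
  have C: "C \<ge> 0" using C0 by (rule conjunct1)
  have C2: "\<exists>v\<in>M \<inter> orth B. norm (y - v) \<le> C * (\<Sum>b\<in>B. cmod (cinner b y))" if "y \<in> M" for y
    using C0 that by (elim conjE) (rule bspec)
  have orth: "orth (insert b B) = orth B \<inter> {x. cinner b x = 0}" unfolding orth_def by auto
  show ?case
  proof (cases "\<forall>x\<in>M \<inter> orth B. cinner b x = 0")
    case True
    then have eq: "M \<inter> orth (insert b B) = M \<inter> orth B" unfolding orth by auto
    have "C * (\<Sum>b\<in>B. cmod (cinner b y)) \<le> C * (\<Sum>b\<in>insert b B. cmod (cinner b y))" for y
      using insert.hyps C by (intro mult_left_mono) auto
    then have "\<exists>v\<in>M \<inter> orth B. norm (y - v) \<le> C * (\<Sum>b\<in>insert b B. cmod (cinner b y))" if "y \<in> M" for y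
      using bexE[OF C2[OF that]] order_trans by metis
    then show ?thesis unfolding eq using C by auto
  next
    case False
    then obtain w0 where w0: "w0 \<in> M" "w0 \<in> orth B" "cinner b w0 \<noteq> 0" by blast
    define w where "w = inverse (cinner b w0) *\<^sub>C w0"
    have w: "w \<in> M" "w \<in> orth B" "cinner b w = 1"
      using w0 complex_vector.subspace_scale[OF assms(2)] complex_vector.subspace_scale[OF csubspace_orth]
      by (auto simp: w_def cinner_scaleC_right)
    define D where "D = C + norm b * C * norm w + norm w"
    have "\<exists>v'\<in>M \<inter> orth (insert b B). norm (y - v') \<le> D * (\<Sum>b\<in>insert b B. cmod (cinner b y))"
      if y: "y \<in> M" for y
    proof -
      define s where "s = (\<Sum>b\<in>B. cmod (cinner b y))"
      define c where "c = cmod (cinner b y)"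
      have s0: "s \<ge> 0" "c \<ge> 0" unfolding s_def c_def by (auto intro: sum_nonneg)
      obtain v where v: "v \<in> M" "v \<in> orth B" "norm (y - v) \<le> C * s"
        using C2[OF y] unfolding s_def by blast
      define v' where "v' = v - cinner b v *\<^sub>C w"
      have "v' \<in> M" "v' \<in> orth B" unfolding v'_def
        using v w assms(2) csubspace_orth
        by (auto intro!: complex_vector.subspace_diff complex_vector.subspace_scale)
      moreover have "cinner b v' = 0"
        by (simp add: v'_def cinner_diff_right cinner_scaleC_right w)
      moreover have "norm (y - v') \<le> D * (s + c)"
      proof -
        have "cmod (cinner b v) \<le> c + cmod (cinner b (y - v))"
          unfolding c_def cinner_diff_right using norm_triangle_sub[of "cinner b v" "cinner b y"]
          by (simp add: norm_minus_commute)
        also have "\<dots> \<le> c + norm b * (C * s)"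
          using norm_cinner_le[of b "y - v"] mult_left_mono[OF v(3), of "norm b"] by simp
        finally have bv: "cmod (cinner b v) \<le> c + norm b * (C * s)" .
        have "norm (y - v') = norm ((y - v) + cinner b v *\<^sub>C w)"
          unfolding v'_def by (simp add: algebra_simps)
        also have "\<dots> \<le> norm (y - v) + cmod (cinner b v) * norm w"
          using norm_triangle_ineq[of "y - v" "cinner b v *\<^sub>C w"] by (simp add: norm_scaleC)
        also have "\<dots> \<le> C * s + (c + norm b * (C * s)) * norm w"
          using v(3) bv by (intro add_mono mult_right_mono) auto
        also have "\<dots> \<le> D * (s + c)"
          unfolding D_def using s0 C by (simp add: algebra_simps)
        finally show ?thesis .
      qed
      moreover have "(\<Sum>b\<in>insert b B. cmod (cinner b y)) = s + c"
        unfolding s_def c_def using insert.hyps by simp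
      ultimately show ?thesis unfolding orth by (intro bexI[of _ v']) auto
    qed
    moreover have "D \<ge> 0" unfolding D_def using C by simp
    ultimately show ?thesis by blast
  qed
qed

text \<open>
  Each further condition lowers the dimension of a subspace by at most one.
\<close>

lemma finite_dimensional_if_orth_trivial:
  fixes V :: "'a::complex_inner set"
  assumes "finite B" "csubspace V" "V \<inter> orth B \<subseteq> {0}"
  shows "\<exists>D. finite D \<and> cspan D = V"
  using assms
proof (induction arbitrary: V)
  case empty
  then have "V = {0}" using complex_vector.subspace_0[of V] by (auto simp: orth_def)
  then show ?case by (intro exI[of _ "{}"]) auto
next
  case (insert b B)
  define V' where "V' = V \<inter> orth {b}"
  have V': "csubspace V'" unfolding V'_def
    using insert.prems by (intro complex_vector.subspace_inter csubspace_orth)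
  have "V' \<inter> orth B \<subseteq> {0}" using insert.prems by (auto simp: V'_def orth_def)
  then obtain D where D: "finite D" "cspan D = V'" using insert.IH[OF V'] by blast
  show ?case
  proof (cases "V = V'")
    case False
    then obtain w where w: "w \<in> V" "cinner b w \<noteq> 0" unfolding V'_def orth_def by auto
    have "cspan (insert w D) = V"
    proof
      show "cspan (insert w D) \<subseteq> V"
        using w D insert.prems complex_vector.span_superset[of D]
        by (intro complex_vector.span_minimal) (auto simp: V'_def)
      show "V \<subseteq> cspan (insert w D)"
      proof
        fix x assume x: "x \<in> V"
        define k where "k = cinner b x / cinner b w"
        have "x - k *\<^sub>C w \<in> V'"
          unfolding V'_def orth_def using x w insert.prems
          by (auto simp: cinner_diff_right cinner_scaleC_right k_def
              intro!: complex_vector.subspace_diff complex_vector.subspace_scale)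
        then have "x - k *\<^sub>C w \<in> cspan (insert w D)"
          using D complex_vector.span_mono[of D "insert w D"] by auto
        moreover have "k *\<^sub>C w \<in> cspan (insert w D)"
          by (intro complex_vector.span_scale complex_vector.span_base) simp
        ultimately have "(x - k *\<^sub>C w) + k *\<^sub>C w \<in> cspan (insert w D)"
          by (rule complex_vector.span_add)
        then show "x \<in> cspan (insert w D)" by simp
      qed
    qed
    then show ?thesis using D(1) by (intro exI[of _ "insert w D"]) auto
  qed (use D in blast)
qed

text \<open>
  Bolzano--Weierstrass for the finitely many bounded coefficient sequences, one subsequence after the
  other.
\<close>

lemma bounded_seq_inner_subseq:
  fixes x :: "nat \<Rightarrow> 'a::complex_inner"
  assumes "finite B" "\<And>n. norm (x n) \<le> 1"
  shows "\<exists>r::nat \<Rightarrow> nat. strict_mono r \<and> (\<forall>b\<in>B. convergent (\<lambda>n. cinner b (x (r n))))"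
  using assms(1)
proof induction
  case empty
  show ?case by (intro exI[of _ id]) (auto simp: strict_mono_def)
next
  case (insert b B)
  then obtain r :: "nat \<Rightarrow> nat" where r: "strict_mono r" "\<And>b. b \<in> B \<Longrightarrow> convergent (\<lambda>n. cinner b (x (r n)))"
    by blast
  have "bounded (range (\<lambda>n. cinner b (x (r n))))"
  proof (rule boundedI)
    fix z assume "z \<in> range (\<lambda>n. cinner b (x (r n)))"
    then obtain n where "z = cinner b (x (r n))" by blast
    then show "cmod z \<le> norm b"
      using norm_cinner_le[of b "x (r n)"] mult_left_mono[OF assms(2)[of "r n"], of "norm b"] by simp
  qed
  then obtain l s where s: "strict_mono s" "((\<lambda>n. cinner b (x (r n))) \<circ> s) \<longlonglongrightarrow> l"
    using bounded_imp_convergent_subsequence by blast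
  have "convergent (\<lambda>n. cinner c (x ((r \<circ> s) n)))" if "c \<in> insert b B" for c
  proof (cases "c = b")
    case True then show ?thesis using s(2) by (auto simp: convergent_def comp_def)
  next
    case False
    then show ?thesis using convergent_subseq_convergent[OF r(2) s(1)] that by (simp add: comp_def)
  qed
  then show ?case using strict_mono_o[OF r(1) s(1)] by blast
qed

section \<open>Essential bounds and pinched operators\<close>

text \<open>
  Bounds for the quadratic form of \<open>T\<^sup>* T\<close> that hold up to a finite-dimensional error.  They
  stand in for the essential spectrum of \<open>T\<^sup>* T\<close>: on an infinite-dimensional Hilbert space, the
  supremum of the essential lower bounds is its least point.
\<close>

definition essentially_ge :: "('a::complex_inner \<Rightarrow> 'b::complex_inner) \<Rightarrow> real \<Rightarrow> bool"
  where "essentially_ge T c \<longleftrightarrow>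
    (\<exists>B. finite B \<and> (\<forall>x\<in>orth B. c * (norm x)\<^sup>2 \<le> (norm (T x))\<^sup>2))"

definition essentially_le :: "('a::complex_inner \<Rightarrow> 'b::complex_inner) \<Rightarrow> real \<Rightarrow> bool"
  where "essentially_le T c \<longleftrightarrow>
    (\<exists>B. finite B \<and> (\<forall>x\<in>orth B. (norm (T x))\<^sup>2 \<le> c * (norm x)\<^sup>2))"

text \<open>
  In spectral terms: the essential spectrum of \<open>T\<^sup>* T\<close> is contained in \<open>{c}\<close>, and above \<open>c\<close> there are only
  finitely many eigenvalues, counted with multiplicity.  Below \<open>c\<close> the eigenvalues may accumulate, but
  only at \<open>c\<close>.
\<close>

definition pinched :: "('a::complex_inner \<Rightarrow> 'b::complex_inner) \<Rightarrow> bool"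
  where "pinched T \<longleftrightarrow> (\<exists>c. essentially_le T c \<and> (\<forall>a<c. essentially_ge T a))"

section \<open>Pinched operators are absolutely minimum attaining\<close>

lemma minimum_modulus_on_le:
  assumes "x \<in> M" "norm x = 1"
  shows "minimum_modulus_on M S \<le> norm (S x)"
  unfolding minimum_modulus_on_def using assms
  by (intro cInf_lower) (auto intro!: bdd_belowI[of _ 0])

lemma minimum_modulus_on_nonneg:
  assumes "x \<in> M" "norm x = 1"
  shows "0 \<le> minimum_modulus_on M S"
  unfolding minimum_modulus_on_def using assms
  by (intro cInf_greatest) auto

lemma unit_vector_in_csubspace:
  assumes "csubspace M" "x \<in> M" "x \<noteq> (0::'a::complex_inner)"
  obtains u where "u \<in> M" "norm u = 1" "x = norm x *\<^sub>R u"
  using assms subspace_scale[OF csubspace_imp_subspace[OF assms(1)] assms(2), of "1 / norm x"]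
  by (intro that[of "(1 / norm x) *\<^sub>R x"]) auto

lemma minimum_modulus_on_bound:
  assumes "csubspace M" "x \<in> M" "bounded_clinear T"
  shows "minimum_modulus_on M T * norm x \<le> norm (T x)"
proof (cases "x = 0")
  case False
  obtain u where u: "u \<in> M" "norm u = 1" "x = norm x *\<^sub>R u"
    using unit_vector_in_csubspace[OF assms(1,2) False] .
  have "norm (T x) = norm x * norm (T u)"
    by (subst u(3)) (simp add: bounded_clinearD[OF assms(3)])
  then show ?thesis using minimum_modulus_on_le[OF u(1,2), of T] by (simp add: mult.commute mult_left_mono)
qed (simp add: bounded_clinearD[OF assms(3)])

lemma minimum_modulus_on_sequence:
  assumes "csubspace M" "M \<noteq> {0}"
  obtains x where "\<And>n. x n \<in> M" "\<And>n. norm (x n) = 1"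
    "(\<lambda>n. norm (S (x n))) \<longlonglongrightarrow> minimum_modulus_on M S"
proof -
  define m where "m = minimum_modulus_on M S"
  obtain y where "y \<in> M" "y \<noteq> 0" using assms complex_vector.subspace_0[OF assms(1)] by auto
  then obtain u where u: "u \<in> M" "norm u = 1" using unit_vector_in_csubspace[OF assms(1)] by metis
  have "\<exists>x. x \<in> M \<and> norm x = 1 \<and> norm (S x) < m + 1 / real (Suc n)" for n
  proof -
    have "Inf {norm (S x) |x. x \<in> M \<and> norm x = 1} < m + 1 / real (Suc n)"
      unfolding m_def minimum_modulus_on_def by simp
    then show ?thesis using u by (subst (asm) cInf_less_iff) (auto intro!: bdd_belowI[of _ 0])
  qed
  then obtain x where x: "\<And>n. x n \<in> M" "\<And>n. norm (x n) = 1"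
    "\<And>n. norm (S (x n)) < m + 1 / real (Suc n)" by metis
  have "(\<lambda>n. norm (S (x n))) \<longlonglongrightarrow> m"
  proof (rule tendsto_sandwich[of "\<lambda>_. m" _ _ "\<lambda>n. m + 1 / real (Suc n)"])
    show "(\<lambda>n. m + 1 / real (Suc n)) \<longlonglongrightarrow> m"
      using tendsto_add[OF tendsto_const[of m] LIMSEQ_Suc[OF lim_1_over_n]] by simp
  qed (use x minimum_modulus_on_le[of _ M S] m_def in \<open>auto intro!: always_eventually less_imp_le\<close>)
  then show ?thesis using that x unfolding m_def by blast
qed

text \<open>
  The parallelogram law for the form \<open>\<parallel>T x\<parallel>\<^sup>2 - c \<parallel>x\<parallel>\<^sup>2\<close>, with its
  value at \<open>x + y\<close> dropped because the form is nonnegative there.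
\<close>

lemma quadratic_form_parallelogram:
  assumes "bounded_clinear T" "\<And>z. z \<in> M \<Longrightarrow> c * (norm z)\<^sup>2 \<le> (norm (T z))\<^sup>2" "x + y \<in> M"
  shows "(norm (T (x - y)))\<^sup>2 - c * (norm (x - y))\<^sup>2
     \<le> 2 * ((norm (T x))\<^sup>2 - c * (norm x)\<^sup>2) + 2 * ((norm (T y))\<^sup>2 - c * (norm y)\<^sup>2)"
proof -
  have "(norm (T (x - y)))\<^sup>2 + (norm (T (x + y)))\<^sup>2 = 2 * (norm (T x))\<^sup>2 + 2 * (norm (T y))\<^sup>2"
    unfolding bounded_clinearD[OF assms(1)] power2_norm_eq_inner by (simp add: algebra_simps)
  moreover have "(norm (x - y))\<^sup>2 + (norm (x + y))\<^sup>2 = 2 * (norm x)\<^sup>2 + 2 * (norm y)\<^sup>2"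
    unfolding power2_norm_eq_inner by (simp add: algebra_simps)
  then have "c * (norm (x - y))\<^sup>2 + c * (norm (x + y))\<^sup>2 = 2 * (c * (norm x)\<^sup>2) + 2 * (c * (norm y)\<^sup>2)"
    by (metis (no_types, lifting) distrib_left mult.left_commute)
  ultimately show ?thesis using assms(2)[OF assms(3)] by simp
qed

text \<open>
  Let \<open>m\<close> be the minimum modulus and \<open>Q x = \<parallel>T x\<parallel>\<^sup>2 - m\<^sup>2 \<parallel>x\<parallel>\<^sup>2\<close>,
  which is nonnegative on \<open>M\<close> and bounded below by a positive multiple of \<open>\<parallel>x\<parallel>\<^sup>2\<close> on the part of \<open>M\<close>
  that is orthogonal to \<open>B\<close>.  A minimizing sequence \<open>x n\<close> may be chosen such that its inner products
  with \<open>B\<close> converge.  Then differences of its members have small \<open>Q\<close> by the parallelogram law and are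
  almost orthogonal to \<open>B\<close>, so they are small, and the sequence converges to a minimizer.
\<close>

lemma minimum_attained_if_gap:
  fixes T :: "'a::chilbert_space \<Rightarrow> 'b::complex_inner"
  assumes T: "bounded_clinear T" and M: "csubspace M" "closed M" "M \<noteq> {0}"
    and B: "finite B" "\<And>x. x \<in> M \<inter> orth B \<Longrightarrow> a * (norm x)\<^sup>2 \<le> (norm (T x))\<^sup>2"
    and a: "a > (minimum_modulus_on M T)\<^sup>2"
  shows "minimum_attaining_on M T"
proof -
  define m where "m = minimum_modulus_on M T"
  define Q where "Q x = (norm (T x))\<^sup>2 - m\<^sup>2 * (norm x)\<^sup>2" for x
  obtain x0 where x0: "\<And>n. x0 n \<in> M" "\<And>n. norm (x0 n) = 1" "(\<lambda>n. norm (T (x0 n))) \<longlonglongrightarrow> m"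
    using minimum_modulus_on_sequence[OF M(1,3), of T] unfolding m_def by metis
  have m0: "m \<ge> 0" unfolding m_def using minimum_modulus_on_nonneg[OF x0(1,2)] .
  have low: "m\<^sup>2 * (norm z)\<^sup>2 \<le> (norm (T z))\<^sup>2" if "z \<in> M" for z
    using power_mono[OF minimum_modulus_on_bound[OF M(1) that T], of 2] m0
    unfolding m_def[symmetric] by (simp add: power_mult_distrib)
  have par: "Q (x - y) \<le> 2 * Q x + 2 * Q y" if "x \<in> M" "y \<in> M" for x y
    unfolding Q_def using quadratic_form_parallelogram[OF T low complex_vector.subspace_add[OF M(1) that]] .
  obtain r :: "nat \<Rightarrow> nat" where r: "strict_mono r" "\<And>b. b \<in> B \<Longrightarrow> convergent (\<lambda>n. cinner b (x0 (r n)))"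
    using bounded_seq_inner_subseq[OF B(1), of x0] x0(2) by (metis order_refl)
  define x where "x n = x0 (r n)" for n
  have x: "x n \<in> M" "norm (x n) = 1" for n using x0 by (auto simp: x_def)
  have xlim: "(\<lambda>n. norm (T (x n))) \<longlonglongrightarrow> m"
    using LIMSEQ_subseq_LIMSEQ[OF x0(3) r(1)] by (simp add: x_def comp_def)
  obtain C where C0: "C \<ge> 0 \<and> (\<forall>y\<in>M. \<exists>v\<in>M \<inter> orth B. norm (y - v) \<le> C * (\<Sum>b\<in>B. cmod (cinner b y)))"
    using approximate_in_orth[OF B(1) M(1)] by (rule exE)
  have C: "C \<ge> 0" using C0 by (rule conjunct1)
  have C2: "\<exists>v\<in>M \<inter> orth B. norm (y - v) \<le> C * (\<Sum>b\<in>B. cmod (cinner b y))" if "y \<in> M" for y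
    using C0 that by (elim conjE) (rule bspec)
  obtain K where K: "K > 0" "\<And>x. norm (T x) \<le> K * norm x" using bounded_clinear_bound[OF T] by blast
  define \<delta> where "\<delta> = a - m\<^sup>2"
  have \<delta>: "\<delta> > 0" using a unfolding \<delta>_def m_def by simp
  \<comment> \<open>For \<open>y\<close> in \<open>M\<close> the quantity \<open>s y\<close> bounds the distance of \<open>y\<close> to the part of \<open>M\<close> on which \<open>Q\<close> is coercive.\<close>
  define s where "s y = C * (\<Sum>b\<in>B. cmod (cinner b y))" for y
  have key: "\<delta> * (norm y)\<^sup>2 \<le> 4 * Q y + (4 * K\<^sup>2 + 2 * \<delta>) * (s y)\<^sup>2" if y: "y \<in> M" for y
  proof -
    obtain v where v: "v \<in> M" "v \<in> orth B" "norm (y - v) \<le> s y" using C2[OF y] unfolding s_def by blast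
    have yv: "(norm (y - v))\<^sup>2 \<le> (s y)\<^sup>2" using v(3) by (simp add: power_mono)
    have "\<delta> * (norm v)\<^sup>2 \<le> Q v" using B(2)[of v] v unfolding \<delta>_def Q_def by (simp add: algebra_simps)
    also have "Q v \<le> 2 * Q y + 2 * Q (y - v)"
      using par[OF y complex_vector.subspace_diff[OF M(1) y v(1)]] by simp
    also have "Q (y - v) \<le> K\<^sup>2 * (norm (y - v))\<^sup>2"
      using power_mono[OF K(2)[of "y - v"] norm_ge_zero, of 2]
        mult_nonneg_nonneg[OF zero_le_power2[of m] zero_le_power2[of "norm (y - v)"]]
      unfolding Q_def power_mult_distrib by linarith
    also have "K\<^sup>2 * (norm (y - v))\<^sup>2 \<le> K\<^sup>2 * (s y)\<^sup>2" using yv by (intro mult_left_mono) auto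
    finally have 1: "\<delta> * (norm v)\<^sup>2 \<le> 2 * Q y + 2 * (K\<^sup>2 * (s y)\<^sup>2)" by simp
    have "(norm y)\<^sup>2 + (norm (v - (y - v)))\<^sup>2 = 2 * (norm v)\<^sup>2 + 2 * (norm (y - v))\<^sup>2"
      unfolding power2_norm_eq_inner by (simp add: algebra_simps inner_commute)
    then have "(norm y)\<^sup>2 \<le> 2 * (norm v)\<^sup>2 + 2 * (s y)\<^sup>2"
      using yv zero_le_power2[of "norm (v - (y - v))"] by linarith
    then have "\<delta> * (norm y)\<^sup>2 \<le> \<delta> * (2 * (norm v)\<^sup>2 + 2 * (s y)\<^sup>2)" using \<delta> by (intro mult_left_mono) auto
    then show ?thesis using 1 by (simp add: algebra_simps)
  qed
  have Qlim: "(\<lambda>n. Q (x n)) \<longlonglongrightarrow> 0"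
  proof -
    have "(\<lambda>n. (norm (T (x n)))\<^sup>2 - m\<^sup>2 * 1) \<longlonglongrightarrow> m\<^sup>2 - m\<^sup>2 * 1" by (intro tendsto_intros xlim)
    then show ?thesis by (simp add: Q_def x)
  qed
  have "Cauchy x"
  proof (rule metric_CauchyI)
    fix e :: real assume e: "e > 0"
    \<comment> \<open>The constants are chosen such that the two terms of the estimate \<open>key\<close> for a difference
      \<open>y\<close> contribute at most \<open>\<delta> e\<^sup>2 / 2\<close> and \<open>\<delta> e\<^sup>2 / 4\<close>.\<close>
    define K' where "K' = 4 * K\<^sup>2 + 2 * \<delta>"
    have K': "K' > 0" unfolding K'_def using \<delta> by (simp add: add_nonneg_pos)
    define \<eta> where "\<eta> = sqrt (\<delta> * e\<^sup>2 / (4 * K'))"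
    have \<eta>: "\<eta> > 0" "K' * \<eta>\<^sup>2 = \<delta> * e\<^sup>2 / 4" unfolding \<eta>_def using \<delta> e K' by (simp_all add: field_simps)
    define \<theta> where "\<theta> = \<eta> / (C * card B + 1)"
    have \<theta>: "\<theta> > 0" unfolding \<theta>_def using \<eta>(1) C by (intro divide_pos_pos add_nonneg_pos) auto
    have "\<forall>\<^sub>F n in sequentially. Q (x n) < \<delta> * e\<^sup>2 / 32"
      using Qlim \<delta> e by (intro order_tendstoD) auto
    then obtain N1 where N1: "\<And>n. n \<ge> N1 \<Longrightarrow> Q (x n) < \<delta> * e\<^sup>2 / 32"
      unfolding eventually_sequentially by blast
    have "\<exists>N. \<forall>k\<ge>N. \<forall>l\<ge>N. dist (cinner b (x k)) (cinner b (x l)) < \<theta>" if "b \<in> B" for b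
      using convergent_Cauchy[OF r(2)[OF that]] \<theta> unfolding Cauchy_def x_def by blast
    then obtain N2 where N2: "\<And>b k l. b \<in> B \<Longrightarrow> k \<ge> N2 b \<Longrightarrow> l \<ge> N2 b \<Longrightarrow> dist (cinner b (x k)) (cinner b (x l)) < \<theta>"
      by metis
    define N where "N = max N1 (Max (insert 0 (N2 ` B)))"
    have NN: "N \<ge> N1" "\<And>b. b \<in> B \<Longrightarrow> N \<ge> N2 b" unfolding N_def using B(1) by (auto simp: le_max_iff_disj)
    have "dist (x k) (x l) < e" if kl: "k \<ge> N" "l \<ge> N" for k l
    proof -
      define y where "y = x k - x l"
      have yM: "y \<in> M" unfolding y_def using x M(1) by (simp add: complex_vector.subspace_diff)
      have "(\<Sum>b\<in>B. cmod (cinner b y)) \<le> of_nat (card B) * \<theta>"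
      proof (rule sum_bounded_above)
        fix b assume "b \<in> B"
        then have "dist (cinner b (x k)) (cinner b (x l)) < \<theta>" using N2 NN(2) kl order_trans by blast
        then show "cmod (cinner b y) \<le> \<theta>" by (simp add: y_def cinner_diff_right dist_norm)
      qed
      then have "s y \<le> C * (of_nat (card B) * \<theta>)" unfolding s_def using C by (rule mult_left_mono)
      also have "\<dots> \<le> \<eta>"
      proof -
        have "C * card B * \<eta> \<le> (C * card B + 1) * \<eta>" using \<eta>(1) by simp
        moreover have "C * card B + 1 > 0" using C by (intro add_nonneg_pos) auto
        ultimately show ?thesis unfolding \<theta>_def by (simp add: field_simps)
      qed
      finally have "s y \<le> \<eta>" .
      moreover have "s y \<ge> 0" unfolding s_def using C by (simp add: sum_nonneg)
      ultimately have "K' * (s y)\<^sup>2 \<le> \<delta> * e\<^sup>2 / 4"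
        unfolding \<eta>(2)[symmetric] using K' by (intro mult_left_mono power_mono) auto
      moreover have "Q y \<le> 2 * Q (x k) + 2 * Q (x l)" unfolding y_def by (intro par x)
      moreover have "Q (x k) < \<delta> * e\<^sup>2 / 32" "Q (x l) < \<delta> * e\<^sup>2 / 32" using N1 NN kl by auto
      ultimately have "\<delta> * (norm y)\<^sup>2 < \<delta> * e\<^sup>2"
        using key[OF yM, folded K'_def] mult_pos_pos[OF \<delta> zero_less_power[OF e, of 2]] by linarith
      then have "(norm y)\<^sup>2 < e\<^sup>2" using \<delta> by simp
      then show ?thesis using e unfolding y_def dist_norm by (intro power_less_imp_less_base[of _ 2 e]) auto
    qed
    then show "\<exists>N. \<forall>k\<ge>N. \<forall>l\<ge>N. dist (x k) (x l) < e" by blast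
  qed
  then obtain q where q: "x \<longlonglongrightarrow> q" using Cauchy_convergent convergent_def by blast
  have "q \<in> M" using closed_sequentially[OF M(2)] x(1) q by blast
  moreover have "norm q = 1" using LIMSEQ_unique[OF tendsto_norm[OF q]] x(2) by simp
  moreover have "norm (T q) = m"
    using LIMSEQ_unique[OF tendsto_norm[OF bounded_linear.tendsto[OF bounded_clinearD(1)[OF T] q]] xlim] .
  ultimately show ?thesis unfolding minimum_attaining_on_def m_def by blast
qed

text \<open>
  If the squared minimum modulus on \<open>M\<close> is below \<open>c\<close>, then some essential lower bound lies strictly above
  it and provides the gap.  Otherwise every unit vector of \<open>M\<close> in the subspace where \<open>c\<close> is an upper bound is
  a minimizer; if there is none, then the gap condition holds vacuously.
\<close>

lemma pinched_imp_absolutely_minimum_attaining: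
  fixes T :: "'a::chilbert_space \<Rightarrow> 'b::complex_inner"
  assumes T: "bounded_clinear T" and "pinched T"
  shows "absolutely_minimum_attaining T"
  unfolding absolutely_minimum_attaining_def
proof (intro conjI T allI impI; elim conjE)
  fix M :: "'a set" assume M: "csubspace M" "closed M" "M \<noteq> {0}"
  obtain c where c: "essentially_le T c" "\<And>a. a < c \<Longrightarrow> essentially_ge T a"
    using assms(2) unfolding pinched_def by blast
  define m where "m = minimum_modulus_on M T"
  obtain y where "y \<in> M" "y \<noteq> 0" using M complex_vector.subspace_0[OF M(1)] by auto
  then obtain y where "y \<in> M" "norm y = 1" using unit_vector_in_csubspace[OF M(1)] by metis
  then have m0: "m \<ge> 0" unfolding m_def by (rule minimum_modulus_on_nonneg)
  show "minimum_attaining_on M T"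
  proof (cases "m\<^sup>2 < c")
    case True
    then obtain a where a: "m\<^sup>2 < a" "a < c" using dense by blast
    obtain B where B: "finite B" "\<And>x. x \<in> orth B \<Longrightarrow> a * (norm x)\<^sup>2 \<le> (norm (T x))\<^sup>2"
      using c(2)[OF a(2)] unfolding essentially_ge_def by blast
    show ?thesis
      by (rule minimum_attained_if_gap[OF T M B(1) _ a(1)[unfolded m_def]]) (use B(2) in auto)
  next
    case False
    obtain B where B: "finite B" "\<And>x. x \<in> orth B \<Longrightarrow> (norm (T x))\<^sup>2 \<le> c * (norm x)\<^sup>2"
      using c(1) unfolding essentially_le_def by blast
    show ?thesis
    proof (cases "M \<inter> orth B \<subseteq> {0}")
      case True
      then have "(m\<^sup>2 + 1) * (norm x)\<^sup>2 \<le> (norm (T x))\<^sup>2" if "x \<in> M \<inter> orth B" for x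
        using that by auto
      then show ?thesis
        using minimum_attained_if_gap[OF T M B(1), of "m\<^sup>2 + 1"] unfolding m_def by simp
    next
      case False
      then obtain x where "x \<in> M \<inter> orth B" "x \<noteq> 0" by blast
      then obtain u where u: "u \<in> M \<inter> orth B" "norm u = 1"
        using unit_vector_in_csubspace complex_vector.subspace_inter[OF M(1) csubspace_orth] by metis
      have "(norm (T u))\<^sup>2 \<le> m\<^sup>2" using B(2)[of u] u \<open>\<not> m\<^sup>2 < c\<close> by simp
      then have "norm (T u) \<le> m" using m0 by (rule power2_le_imp_le)
      then have "norm (T u) = m" using minimum_modulus_on_le[of u M T] u unfolding m_def by simp
      then show ?thesis unfolding minimum_attaining_on_def m_def using u by blast
    qed
  qed
qed

section \<open>Absolutely minimum attaining operators are pinched\<close>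

text \<open>
  The values of \<open>\<parallel>T z\<parallel>\<^sup>2\<close> on unit vectors of a subspace form an interval: the
  intermediate value theorem applies on the segment from \<open>y\<close> to \<open>x\<close>, which avoids \<open>0\<close> because the
  quotient \<open>\<parallel>T z\<parallel>\<^sup>2 / \<parallel>z\<parallel>\<^sup>2\<close> is constant on a line through \<open>0\<close>.
\<close>

lemma exists_unit_vector_between:
  assumes T: "bounded_clinear T" and M: "csubspace M" "x \<in> M" "y \<in> M"
    and "a < b" "a * (norm x)\<^sup>2 < (norm (T x))\<^sup>2" "(norm (T y))\<^sup>2 < b * (norm y)\<^sup>2"
  obtains z where "z \<in> M" "norm z = 1" "a < (norm (T z))\<^sup>2" "(norm (T z))\<^sup>2 < b"
proof -
  note Tl = bounded_clinearD[OF T]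
  have 0: "x \<noteq> 0" "y \<noteq> 0" using assms Tl by auto
  have "\<exists>z\<in>M. z \<noteq> 0 \<and> a * (norm z)\<^sup>2 < (norm (T z))\<^sup>2 \<and> (norm (T z))\<^sup>2 < b * (norm z)\<^sup>2"
  proof (cases "(norm (T x))\<^sup>2 < b * (norm x)\<^sup>2 \<or> a * (norm y)\<^sup>2 < (norm (T y))\<^sup>2")
    case True then show ?thesis using assms 0 by blast
  next
    case False
    then have x: "b * (norm x)\<^sup>2 \<le> (norm (T x))\<^sup>2" and y: "(norm (T y))\<^sup>2 \<le> a * (norm y)\<^sup>2" by auto
    define c where "c = (a + b) / 2"
    have c: "a < c" "c < b" unfolding c_def using \<open>a < b\<close> by auto
    define z where "z t = y + t *\<^sub>R (x - y)" for t :: real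
    have zM: "z t \<in> M" for t
      unfolding z_def using M csubspace_imp_subspace[OF M(1)]
      by (intro subspace_add subspace_scale subspace_diff)
    define f where "f t = (norm (T (z t)))\<^sup>2 - c * (norm (z t))\<^sup>2" for t
    have fT: "f t = (norm (T y + t *\<^sub>R (T x - T y)))\<^sup>2 - c * (norm (z t))\<^sup>2" for t
      unfolding f_def z_def by (simp add: Tl)
    have "\<exists>t. 0 \<le> t \<and> t \<le> 1 \<and> f t = 0"
    proof (rule IVT)
      have "a * (norm y)\<^sup>2 \<le> c * (norm y)\<^sup>2" using c by (intro mult_right_mono) auto
      then show "f 0 \<le> 0" using y by (simp add: f_def z_def)
      have "c * (norm x)\<^sup>2 \<le> b * (norm x)\<^sup>2" using c by (intro mult_right_mono) auto
      then show "0 \<le> f 1" using x by (simp add: f_def z_def)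
      show "\<forall>t. 0 \<le> t \<and> t \<le> 1 \<longrightarrow> isCont f t"
        unfolding fT z_def by (intro allI impI continuous_intros)
    qed simp
    then obtain t where t: "f t = 0" by blast
    have "z t \<noteq> 0"
    proof
      assume z0: "z t = 0"
      then have "t \<noteq> 0" using 0 by (auto simp: z_def)
      define r where "r = (t - 1) / t"
      have "t *\<^sub>R x = (t - 1) *\<^sub>R y" using z0 by (simp add: z_def algebra_simps)
      then have "inverse t *\<^sub>R (t *\<^sub>R x) = r *\<^sub>R y"
        unfolding r_def by (simp add: divide_inverse mult.commute)
      then have xr: "x = r *\<^sub>R y" using \<open>t \<noteq> 0\<close> by simp
      have "(norm (T x))\<^sup>2 = r\<^sup>2 * (norm (T y))\<^sup>2" unfolding xr by (simp add: Tl power_mult_distrib)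
      also have "\<dots> \<le> r\<^sup>2 * (a * (norm y)\<^sup>2)" using y by (intro mult_left_mono) auto
      also have "\<dots> = a * (norm x)\<^sup>2" unfolding xr by (simp add: power_mult_distrib)
      finally show False using assms by simp
    qed
    moreover have "(norm (T (z t)))\<^sup>2 = c * (norm (z t))\<^sup>2" using t by (simp add: f_def)
    moreover have "(norm (z t))\<^sup>2 > 0" using \<open>z t \<noteq> 0\<close> by simp
    ultimately show ?thesis using zM[of t] c by (intro bexI[of _ "z t"]) simp_all
  qed
  then obtain z where z: "z \<in> M" "z \<noteq> 0" "a * (norm z)\<^sup>2 < (norm (T z))\<^sup>2" "(norm (T z))\<^sup>2 < b * (norm z)\<^sup>2"
    by blast
  obtain u where u: "u \<in> M" "norm u = 1" "z = norm z *\<^sub>R u"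
    using unit_vector_in_csubspace[OF M(1) z(1,2)] by blast
  have "(norm (T z))\<^sup>2 = (norm z)\<^sup>2 * (norm (T u))\<^sup>2"
    by (subst u(3)) (simp add: Tl power_mult_distrib)
  then have "a < (norm (T u))\<^sup>2" "(norm (T u))\<^sup>2 < b" using z by (simp_all add: mult.commute[of _ "(norm z)\<^sup>2"])
  then show ?thesis using that u by blast
qed

lemma essentially_ge_mono:
  fixes T :: "'a::complex_inner \<Rightarrow> 'b::complex_inner"
  assumes "essentially_ge T a" "b \<le> a"
  shows "essentially_ge T b"
proof -
  obtain B where B: "finite B" "\<And>x. x \<in> orth B \<Longrightarrow> a * (norm x)\<^sup>2 \<le> (norm (T x))\<^sup>2"
    using assms(1) unfolding essentially_ge_def by blast
  have "b * (norm x)\<^sup>2 \<le> (norm (T x))\<^sup>2" if "x \<in> orth B" for x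
    using B(2)[OF that] mult_right_mono[OF assms(2) zero_le_power2, of "norm x"] by simp
  then show ?thesis unfolding essentially_ge_def using B(1) by blast
qed

lemma essentially_ge_0: "essentially_ge T 0"
  unfolding essentially_ge_def by (intro exI[of _ "{}"]) simp

lemma pinched_finite_dimensional:
  fixes T :: "'a::complex_inner \<Rightarrow> 'b::complex_inner" and B :: "'a set"
  assumes "finite B" "orth B \<subseteq> {0}" "T 0 = 0"
  shows "pinched T"
proof -
  have "x = 0" if "x \<in> orth B" for x using assms that by auto
  then have "(norm (T x))\<^sup>2 \<le> 0 * (norm x)\<^sup>2" "a * (norm x)\<^sup>2 \<le> (norm (T x))\<^sup>2" if "x \<in> orth B" for x a
    using that assms(3) \<open>\<And>x. x \<in> orth B \<Longrightarrow> x = 0\<close>[OF that] by simp_all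
  then have "essentially_le T 0" "essentially_ge T a" for a
    unfolding essentially_le_def essentially_ge_def using assms(1) by blast+
  then show ?thesis unfolding pinched_def by blast
qed

text \<open>
  In infinite dimension the essential lower bounds are bounded above by \<open>\<parallel>T\<parallel>\<^sup>2\<close>, hence have
  a supremum.  In finite dimension every real number is one of them, and this is why that case is
  separated in the sequel by \<open>pinched_finite_dimensional\<close>.
\<close>

lemma essential_bottom:
  fixes T :: "'a::complex_inner \<Rightarrow> 'b::complex_inner"
  assumes T: "bounded_clinear T" and inf: "\<And>B::'a set. finite B \<Longrightarrow> \<not> orth B \<subseteq> {0}"
  obtains c where "c \<ge> 0" "\<And>a. a < c \<Longrightarrow> essentially_ge T a" "\<And>a. a > c \<Longrightarrow> \<not> essentially_ge T a"
proof -
  define c where "c = Sup {a. essentially_ge T a}"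
  obtain K where K: "\<And>x. norm (T x) \<le> K * norm x" using bounded_clinear_bound[OF T] by blast
  have "a \<le> K\<^sup>2" if a: "essentially_ge T a" for a
  proof -
    obtain B where B: "finite B" "\<And>x. x \<in> orth B \<Longrightarrow> a * (norm x)\<^sup>2 \<le> (norm (T x))\<^sup>2"
      using a unfolding essentially_ge_def by blast
    obtain x where x: "x \<in> orth B" "x \<noteq> 0" using inf[OF B(1)] by blast
    have "a * (norm x)\<^sup>2 \<le> K\<^sup>2 * (norm x)\<^sup>2"
      using B(2)[OF x(1)] power_mono[OF K[of x], of 2] by (simp add: power_mult_distrib)
    then show ?thesis using x(2) by simp
  qed
  then have bdd: "bdd_above {a. essentially_ge T a}" by (intro bdd_aboveI) blast
  have ne: "{a. essentially_ge T a} \<noteq> {}" using essentially_ge_0 by blast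
  show ?thesis
  proof
    show "c \<ge> 0" unfolding c_def using bdd essentially_ge_0 by (intro cSup_upper) auto
    show "essentially_ge T a" if a: "a < c" for a
    proof -
      obtain a' where "essentially_ge T a'" "a < a'"
        using a unfolding c_def less_cSup_iff[OF ne bdd] by blast
      then show ?thesis using essentially_ge_mono by fastforce
    qed
    show "\<not> essentially_ge T a" if "a > c" for a
      using that cSup_upper[OF _ bdd, of a] unfolding c_def by auto
  qed
qed

lemma bounded_linear_scaleC: "bounded_linear (\<lambda>x::'a::complex_inner. c *\<^sub>C x)"
  by (rule bounded_linear_intro[where K = "cmod c"])
    (simp_all add: scaleC_add_right scaleR_scaleC norm_scaleC mult.commute[of c])

lemma csubspace_closure:
  fixes S :: "'a::complex_inner set"
  assumes "csubspace S"
  shows "csubspace (closure S)"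
  unfolding complex_vector.subspace_def
proof (intro conjI ballI allI)
  show "0 \<in> closure S" using closure_subset complex_vector.subspace_0[OF assms] by blast
next
  fix x y assume "x \<in> closure S" "y \<in> closure S"
  then obtain f g where fg: "\<forall>n. f n \<in> S" "f \<longlonglongrightarrow> x" "\<forall>n. g n \<in> S" "g \<longlonglongrightarrow> y"
    by (elim closure_sequential[THEN iffD1, THEN exE] conjE)
  have "\<forall>n. f n + g n \<in> S" using fg complex_vector.subspace_add[OF assms] by simp
  moreover have "(\<lambda>n. f n + g n) \<longlonglongrightarrow> x + y" using fg by (intro tendsto_add)
  ultimately show "x + y \<in> closure S"
    by (intro closure_sequential[THEN iffD2] exI[of _ "\<lambda>n. f n + g n"] conjI)
next
  fix c x assume "x \<in> closure S"
  then obtain f where f: "\<forall>n. f n \<in> S" "f \<longlonglongrightarrow> x"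
    by (elim closure_sequential[THEN iffD1, THEN exE] conjE)
  have "\<forall>n. c *\<^sub>C f n \<in> S" using f complex_vector.subspace_scale[OF assms] by simp
  moreover have "(\<lambda>n. c *\<^sub>C f n) \<longlonglongrightarrow> c *\<^sub>C x"
    using bounded_linear.tendsto[OF bounded_linear_scaleC f(2)] .
  ultimately show "c *\<^sub>C x \<in> closure S"
    by (intro closure_sequential[THEN iffD2] exI[of _ "\<lambda>n. c *\<^sub>C f n"] conjI)
qed

text \<open>
  On finite combinations of \<open>G\<close> the form \<open>\<parallel>T x\<parallel>\<^sup>2 - c \<parallel>x\<parallel>\<^sup>2\<close> is
  diagonal with nonnegative coefficients, so it dominates each single summand.  The resulting inequality
  is a closed condition and extends to the closure, which makes infinite sums unnecessary.
\<close>

lemma quadratic_form_on_span: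
  fixes T :: "'a::complex_inner \<Rightarrow> 'b::complex_inner"
  assumes T: "bounded_clinear T"
    and unit: "\<And>a. a \<in> G \<Longrightarrow> norm a = 1"
    and ortho: "\<And>a b. a \<in> G \<Longrightarrow> b \<in> G \<Longrightarrow> a \<noteq> b \<Longrightarrow> cinner a b = 0"
    and orthoT: "\<And>a b. a \<in> G \<Longrightarrow> b \<in> G \<Longrightarrow> a \<noteq> b \<Longrightarrow> cinner (T a) (T b) = 0"
    and above: "\<And>a. a \<in> G \<Longrightarrow> c \<le> (norm (T a))\<^sup>2"
    and "g \<in> G" "x \<in> closure (cspan G)"
  shows "(cmod (cinner g x))\<^sup>2 * ((norm (T g))\<^sup>2 - c) \<le> (norm (T x))\<^sup>2 - c * (norm x)\<^sup>2"
proof -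
  let ?P = "\<lambda>x. (cmod (cinner g x))\<^sup>2 * ((norm (T g))\<^sup>2 - c) \<le> (norm (T x))\<^sup>2 - c * (norm x)\<^sup>2"
  have P: "?P x" if x: "x \<in> cspan G" for x
  proof -
    obtain t r where t: "finite t" "t \<subseteq> G" and x: "x = (\<Sum>a\<in>t. r a *\<^sub>C a)"
      using x unfolding complex_vector.span_explicit by (elim CollectE exE conjE) (rule that)
    have Tx: "T x = (\<Sum>a\<in>t. r a *\<^sub>C T a)"
      unfolding x linear_sum[OF bounded_linear.linear[OF bounded_clinearD(1)[OF T]]]
      by (simp add: bounded_clinearD[OF T])
    have 1: "(norm x)\<^sup>2 = (\<Sum>a\<in>t. (cmod (r a))\<^sup>2)"
    proof -
      have "(norm x)\<^sup>2 = (\<Sum>a\<in>t. (norm (r a *\<^sub>C a))\<^sup>2)"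
        unfolding x using t ortho
        by (intro norm_sum_Pythagorean)
          (auto simp: pairwise_def orthogonal_def inner_eq_Re_cinner cinner_scaleC_left
            cinner_scaleC_right subset_iff)
      then show ?thesis using unit t by (auto simp: norm_scaleC subset_iff intro!: sum.cong)
    qed
    have 2: "(norm (T x))\<^sup>2 = (\<Sum>a\<in>t. (cmod (r a))\<^sup>2 * (norm (T a))\<^sup>2)"
    proof -
      have "(norm (T x))\<^sup>2 = (\<Sum>a\<in>t. (norm (r a *\<^sub>C T a))\<^sup>2)"
        unfolding Tx using t orthoT
        by (intro norm_sum_Pythagorean)
          (auto simp: pairwise_def orthogonal_def inner_eq_Re_cinner cinner_scaleC_left
            cinner_scaleC_right subset_iff)
      then show ?thesis by (simp add: norm_scaleC power_mult_distrib)
    qed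
    have 3: "(norm (T x))\<^sup>2 - c * (norm x)\<^sup>2 = (\<Sum>a\<in>t. (cmod (r a))\<^sup>2 * ((norm (T a))\<^sup>2 - c))"
      unfolding 1 2 by (simp add: sum_distrib_left sum_subtractf[symmetric] algebra_simps)
    have nonneg: "0 \<le> (cmod (r a))\<^sup>2 * ((norm (T a))\<^sup>2 - c)" if "a \<in> t" for a
      using above[of a] t that by auto
    have "cinner g x = (\<Sum>a\<in>t. r a * cinner g a)"
      unfolding x linear_sum[OF bounded_linear.linear[OF bounded_linear_cinner_right]]
      by (simp add: cinner_scaleC_right)
    also have "\<dots> = (\<Sum>a\<in>t. if a = g then r g else 0)"
      using ortho[OF \<open>g \<in> G\<close>] t unit[OF \<open>g \<in> G\<close>] by (intro sum.cong) (auto simp: cinner_self)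
    also have "\<dots> = (if g \<in> t then r g else 0)" using t by simp
    finally have 4: "cinner g x = (if g \<in> t then r g else 0)" .
    show ?thesis
    proof (cases "g \<in> t")
      case True
      then show ?thesis unfolding 3 4 
        using member_le_sum[of g t "\<lambda>a. (cmod (r a))\<^sup>2 * ((norm (T a))\<^sup>2 - c)"] True nonneg t(1) by simp
    next
      case False
      then show ?thesis unfolding 3 4 using nonneg by (simp add: sum_nonneg)
    qed
  qed
  have "closed {x. ?P x}"
    by (intro closed_Collect_le continuous_intros
      linear_continuous_on[OF bounded_linear_cinner_right]
      linear_continuous_on[OF bounded_clinearD(1)[OF T]])
  then have "closure (cspan G) \<subseteq> {x. ?P x}"
    using P by (intro closure_minimal) auto
  then show ?thesis using assms by blast
qed

text \<open>
  Let \<open>c\<close> be the supremum of the essential lower bounds.  If \<open>c\<close> is not an essential upper bound, then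
  every subspace of finite codimension contains unit vectors \<open>z\<close> with \<open>\<parallel>T z\<parallel>\<^sup>2\<close>
  above \<open>c\<close> and as close to \<open>c\<close> as desired.  Choosing them successively yields an orthonormal sequence
  with orthogonal images and \<open>\<parallel>T (g n)\<parallel>\<^sup>2\<close> tending to \<open>c\<close> from above.  On its closed
  span the infimum of \<open>\<parallel>T x\<parallel>\<^sup>2\<close> over unit vectors is \<open>c\<close>, and it is not attained.
\<close>

lemma absolutely_minimum_attaining_imp_pinched:
  fixes T :: "'a::complex_inner \<Rightarrow> 'b::complex_inner"
  assumes AM: "absolutely_minimum_attaining T" and TS: "adjoint_pair T S"
  shows "pinched T"
proof (cases "\<exists>B::'a set. finite B \<and> orth B \<subseteq> {0}")
  case True
  then show ?thesis
    using pinched_finite_dimensional bounded_clinearD(4)[OF adjoint_pairD(1)[OF TS]] by blast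
next
  case False
  have T: "bounded_clinear T" using TS by (rule adjoint_pairD)
  obtain c where c: "\<And>a. a < c \<Longrightarrow> essentially_ge T a" "\<And>a. a > c \<Longrightarrow> \<not> essentially_ge T a"
    using essential_bottom[OF T] False by metis
  have "essentially_le T c"
  proof (rule ccontr)
    assume nle: "\<not> essentially_le T c"
    have ex: "\<exists>z. z \<in> orth B \<and> norm z = 1 \<and> c < (norm (T z))\<^sup>2 \<and> (norm (T z))\<^sup>2 < b"
      if "finite B" "c < b" for B b
    proof -
      obtain x where "x \<in> orth B" "c * (norm x)\<^sup>2 < (norm (T x))\<^sup>2"
        using nle \<open>finite B\<close> unfolding essentially_le_def by (metis not_less)
      moreover obtain y where "y \<in> orth B" "(norm (T y))\<^sup>2 < b * (norm y)\<^sup>2"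
        using c(2)[OF \<open>c < b\<close>] \<open>finite B\<close> unfolding essentially_ge_def by (metis not_less)
      ultimately show ?thesis
        using exists_unit_vector_between[OF T csubspace_orth _ _ \<open>c < b\<close>] by metis
    qed
    \<comment> \<open>Orthogonality of \<open>z\<close> to \<open>S (T (g k))\<close> means orthogonality of \<open>T z\<close> to \<open>T (g k)\<close>.\<close>
    define P where "P g n z \<longleftrightarrow> z \<in> orth (g ` {..<n} \<union> S ` T ` g ` {..<n}) \<and> norm z = 1 \<and>
      c < (norm (T z))\<^sup>2 \<and> (norm (T z))\<^sup>2 < c + 1 / real (Suc n)" for g :: "nat \<Rightarrow> 'a" and n z
    have "\<exists>g. \<forall>n. P g n (g n)"
    proof (rule dependent_wellorder_choice)
      fix r :: 'a and f g :: "nat \<Rightarrow> 'a" and n :: nat assume "\<And>k. k < n \<Longrightarrow> f k = g k"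
      then have "f ` {..<n} = g ` {..<n}" by auto
      then show "P f n r = P g n r" unfolding P_def by simp
    next
      fix n f show "\<exists>r. P f n r" unfolding P_def by (intro ex) auto
    qed
    then obtain g where g: "\<And>n. P g n (g n)" by blast
    have g_unit: "norm (g n) = 1" and g_bounds: "c < (norm (T (g n)))\<^sup>2" "(norm (T (g n)))\<^sup>2 < c + 1 / real (Suc n)" for n
      using g[of n] unfolding P_def by auto
    have less: "cinner (g k) (g n) = 0 \<and> cinner (T (g k)) (T (g n)) = 0" if "k < n" for k n
    proof -
      have "g n \<in> orth (g ` {..<n} \<union> S ` T ` g ` {..<n})" using g[of n] unfolding P_def by blast
      then have "cinner (g k) (g n) = 0" "cinner (S (T (g k))) (g n) = 0"
        using that unfolding orth_def by auto
      then show ?thesis using adjoint_pairD(4)[OF TS] by simp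
    qed
    have neq: "cinner (g k) (g n) = 0" "cinner (T (g k)) (T (g n)) = 0" if "k \<noteq> n" for k n
      using less[of k n] less[of n k] that cinner_eq_0_commute by (metis nat_neq_iff)+
    define G where "G = range g"
    define M where "M = closure (cspan G)"
    have low: "(cmod (cinner a x))\<^sup>2 * ((norm (T a))\<^sup>2 - c) \<le> (norm (T x))\<^sup>2 - c * (norm x)\<^sup>2"
      if "a \<in> G" "x \<in> M" for a x
    proof (rule quadratic_form_on_span[OF T, where G = G])
      show "a \<in> G" "x \<in> closure (cspan G)" using that unfolding M_def .
      show "cinner a b = 0" "cinner (T a) (T b) = 0" if ab: "a \<in> G" "b \<in> G" "a \<noteq> b" for a b
      proof -
        obtain k n where "a = g k" "b = g n" "k \<noteq> n" using ab unfolding G_def by auto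
        then show "cinner a b = 0" "cinner (T a) (T b) = 0" using neq by simp_all
      qed
    qed (auto simp: G_def g_unit intro: less_imp_le[OF g_bounds(1)])
    have M: "csubspace M" "closed M" unfolding M_def
      by (auto intro: csubspace_closure)
    have gM: "g n \<in> M" for n
    proof -
      have "g n \<in> cspan G" unfolding G_def by (rule complex_vector.span_base) simp
      then show ?thesis unfolding M_def using closure_subset by blast
    qed
    have "M \<noteq> {0}" using gM[of 0] g_unit[of 0] by auto
    then obtain x where x: "x \<in> M" "norm x = 1" "norm (T x) = minimum_modulus_on M T"
      using AM M unfolding absolutely_minimum_attaining_def minimum_attaining_on_def by blast
    have "(norm (T x))\<^sup>2 \<le> c + 1 / real (Suc n)" for n
    proof -
      have "norm (T x) \<le> norm (T (g n))" using minimum_modulus_on_le[OF gM g_unit] x(3) by simp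
      then have "(norm (T x))\<^sup>2 \<le> (norm (T (g n)))\<^sup>2" by (intro power_mono) auto
      then show ?thesis using g_bounds(2)[of n] by linarith
    qed
    moreover have "(\<lambda>n. c + 1 / real (Suc n)) \<longlonglongrightarrow> c"
      using tendsto_add[OF tendsto_const[of c] LIMSEQ_Suc[OF lim_1_over_n]] by simp
    ultimately have Tx: "(norm (T x))\<^sup>2 \<le> c" using LIMSEQ_le_const by blast
    have "cinner a x = 0" if "a \<in> G" for a
    proof -
      have "(cmod (cinner a x))\<^sup>2 * ((norm (T a))\<^sup>2 - c) \<le> 0" using low[OF that x(1)] Tx x(2) by simp
      moreover have "(norm (T a))\<^sup>2 - c > 0" using that g_bounds unfolding G_def by auto
      ultimately show ?thesis by (simp add: mult_le_0_iff)
    qed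
    then have "G \<subseteq> orth {x}" using cinner_eq_0_commute unfolding orth_def by blast
    then have "M \<subseteq> orth {x}" unfolding M_def
      by (intro closure_minimal closed_orth complex_vector.span_minimal csubspace_orth)
    then have "cinner x x = 0" using x(1) unfolding orth_def by blast
    then show False using x(2) by (simp add: cinner_self)
  qed
  then show ?thesis unfolding pinched_def using c(1) by blast
qed

section \<open>Approximate eigenvectors at the bottom of the essential spectrum\<close>

text \<open>
  The vector \<open>z\<close> is half the gradient at \<open>x\<close> of the form
  \<open>Q u = \<parallel>T u\<parallel>\<^sup>2 - a \<parallel>u\<parallel>\<^sup>2\<close>.  Subtracting \<open>z / K\<close> from \<open>x\<close>
  lowers \<open>Q\<close> by at least \<open>\<parallel>z\<parallel>\<^sup>2 / K\<close>, so where \<open>Q\<close> stays nonnegative an almost minimal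
  \<open>x\<close> has a small gradient and is an approximate eigenvector of \<open>S \<circ> T\<close> for \<open>a\<close>.  This replaces the
  spectral theorem in what follows.
\<close>

lemma gradient_bound:
  assumes TS: "adjoint_pair T S" and "K > 0"
    and z: "z = S (T x) - a *\<^sub>R x"
    and upper: "(norm (T z))\<^sup>2 - a * (norm z)\<^sup>2 \<le> K * (norm z)\<^sup>2"
    and nonneg: "a * (norm (x - (1 / K) *\<^sub>R z))\<^sup>2 \<le> (norm (T (x - (1 / K) *\<^sub>R z)))\<^sup>2"
  shows "(norm z)\<^sup>2 \<le> K * ((norm (T x))\<^sup>2 - a * (norm x)\<^sup>2)"
proof -
  note Tl = bounded_clinearD[OF adjoint_pairD(1)[OF TS]]
  define t where "t = 1 / K"
  define q where "q u = (norm (T u))\<^sup>2 - a * (norm u)\<^sup>2" for u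
  have cross: "inner (T x) (T z) - a * inner x z = (norm z)\<^sup>2"
    unfolding adjoint_pair_quadratic_form(1)[OF TS, symmetric] power2_norm_eq_inner
    by (simp add: z algebra_simps inner_commute)
  have 1: "(norm (T (x - t *\<^sub>R z)))\<^sup>2 = (norm (T x))\<^sup>2 - 2 * t * inner (T x) (T z) + t\<^sup>2 * (norm (T z))\<^sup>2"
    unfolding Tl power2_norm_eq_inner by (simp add: algebra_simps inner_commute power2_eq_square)
  have 2: "(norm (x - t *\<^sub>R z))\<^sup>2 = (norm x)\<^sup>2 - 2 * t * inner x z + t\<^sup>2 * (norm z)\<^sup>2"
    unfolding power2_norm_eq_inner by (simp add: algebra_simps inner_commute power2_eq_square)
  have "q (x - t *\<^sub>R z) = q x - 2 * t * (inner (T x) (T z) - a * inner x z) + t\<^sup>2 * q z"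
    unfolding q_def 1 2 by (simp add: algebra_simps)
  then have "0 \<le> q x - 2 * t * (norm z)\<^sup>2 + t\<^sup>2 * q z"
    using nonneg unfolding cross by (simp add: q_def t_def)
  also have "t\<^sup>2 * q z \<le> t\<^sup>2 * (K * (norm z)\<^sup>2)" using upper unfolding q_def by (intro mult_left_mono) auto
  also have "t\<^sup>2 * (K * (norm z)\<^sup>2) = t * (norm z)\<^sup>2" using \<open>K > 0\<close> by (simp add: t_def power2_eq_square)
  finally have "t * (norm z)\<^sup>2 \<le> q x" by simp
  then show ?thesis using \<open>K > 0\<close> unfolding t_def q_def by (simp add: field_simps)
qed

text \<open>
  These are approximate eigenvectors in Weyl's sense: they can be found in every subspace of finite
  codimension.  The gradient bound is applied at the level \<open>a = c - d\<close> slightly below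
  \<open>c\<close>, on a subspace where \<open>a\<close> is a lower bound; making \<open>x\<close> orthogonal to the \<open>S \<circ> T\<close> image of the
  exceptional set keeps the gradient in that subspace.
\<close>

lemma weyl_vector:
  fixes T :: "'a::complex_inner \<Rightarrow> 'b::complex_inner"
  assumes TS: "adjoint_pair T S"
    and c: "\<And>a. a < c \<Longrightarrow> essentially_ge T a" "\<And>a. a > c \<Longrightarrow> \<not> essentially_ge T a"
    and "e > 0" "finite B"
  shows "\<exists>x\<in>orth B. norm x = 1 \<and> norm (S (T x) - c *\<^sub>R x) \<le> e"
proof -
  note T = adjoint_pairD(1)[OF TS]
  obtain K0 where K0: "K0 > 0" "\<And>x. norm (T x) \<le> K0 * norm x" using bounded_clinear_bound[OF T] by blast
  define K where "K = K0\<^sup>2 + \<bar>c\<bar> + 1"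
  have K: "K > 0" unfolding K_def by (simp add: add_nonneg_pos)
  define d where "d = min 1 (min (e / 2) (e\<^sup>2 / (8 * K)))"
  have d: "d > 0" "d \<le> 1" "d \<le> e / 2" "2 * K * d \<le> (e / 2)\<^sup>2"
  proof -
    show "d > 0" "d \<le> 1" "d \<le> e / 2" unfolding d_def using K \<open>e > 0\<close> by auto
    have "d \<le> e\<^sup>2 / (8 * K)" unfolding d_def by simp
    then show "2 * K * d \<le> (e / 2)\<^sup>2" using K by (simp add: field_simps)
  qed
  define a where "a = c - d"
  have "essentially_ge T a" using c(1) d by (simp add: a_def)
  then obtain B0 where B0: "finite B0" "\<And>x. x \<in> orth B0 \<Longrightarrow> a * (norm x)\<^sup>2 \<le> (norm (T x))\<^sup>2"
    unfolding essentially_ge_def by blast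
  have "\<not> essentially_ge T (c + d)" using c(2) d by simp
  moreover have "finite (B \<union> B0 \<union> (S \<circ> T) ` B0)" using B0 \<open>finite B\<close> by simp
  ultimately obtain x where x: "x \<in> orth (B \<union> B0 \<union> (S \<circ> T) ` B0)" "(norm (T x))\<^sup>2 < (c + d) * (norm x)\<^sup>2"
    unfolding essentially_ge_def by (metis not_less)
  have "x \<noteq> 0" using x(2) bounded_clinearD[OF T] by auto
  then obtain u where u: "u \<in> orth (B \<union> B0 \<union> (S \<circ> T) ` B0)" "norm u = 1" "x = norm x *\<^sub>R u"
    using unit_vector_in_csubspace[OF csubspace_orth x(1)] by metis
  have "(norm (T x))\<^sup>2 = (norm x)\<^sup>2 * (norm (T u))\<^sup>2"
    by (subst u(3)) (simp add: bounded_clinearD[OF T] power_mult_distrib)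
  then have Tu: "(norm (T u))\<^sup>2 < c + d" using x(2) \<open>x \<noteq> 0\<close> by (simp add: mult.commute[of _ "(norm x)\<^sup>2"])
  have uB: "u \<in> orth B" "u \<in> orth B0" "S (T u) \<in> orth B0"
    using u(1) mem_orth_image[OF adjoint_pair_comp[OF TS], of u B0] unfolding orth_Un by auto
  define z where "z = S (T u) - a *\<^sub>R u"
  note sub = subspace_diff[OF csubspace_imp_subspace[OF csubspace_orth]]
    subspace_scale[OF csubspace_imp_subspace[OF csubspace_orth]]
  have zB: "z \<in> orth B0" unfolding z_def using uB by (intro sub)
  have "(norm z)\<^sup>2 \<le> K * ((norm (T u))\<^sup>2 - a * (norm u)\<^sup>2)"
  proof (rule gradient_bound[OF TS K z_def])
    have "\<bar>a\<bar> \<le> \<bar>c\<bar> + 1" unfolding a_def using d by simp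
    then have "- (a * (norm z)\<^sup>2) \<le> (\<bar>c\<bar> + 1) * (norm z)\<^sup>2"
      using mult_right_mono[of "- a" "\<bar>c\<bar> + 1" "(norm z)\<^sup>2"] by simp
    then show "(norm (T z))\<^sup>2 - a * (norm z)\<^sup>2 \<le> K * (norm z)\<^sup>2"
      using power_mono[OF K0(2)[of z] norm_ge_zero, of 2]
      unfolding K_def power_mult_distrib by (simp add: algebra_simps)
    show "a * (norm (u - (1 / K) *\<^sub>R z))\<^sup>2 \<le> (norm (T (u - (1 / K) *\<^sub>R z)))\<^sup>2"
      using uB zB by (intro B0(2) sub)
  qed
  also have "\<dots> \<le> K * (2 * d)" using Tu u(2) K by (intro mult_left_mono) (auto simp: a_def)
  also have "\<dots> \<le> (e / 2)\<^sup>2" using d(4) by simp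
  finally have nz: "norm z \<le> e / 2" by (rule power2_le_imp_le) (use \<open>e > 0\<close> in simp)
  have "S (T u) - c *\<^sub>R u = z - d *\<^sub>R u" unfolding z_def a_def by (simp add: algebra_simps)
  then have "norm (S (T u) - c *\<^sub>R u) \<le> norm z + norm (d *\<^sub>R u)" using norm_triangle_ineq4 by metis
  also have "\<dots> \<le> e" using nz d u(2) by simp
  finally show ?thesis using u uB by blast
qed

lemma limit_le:
  fixes f :: "real \<Rightarrow> real"
  assumes "isCont f 0" "\<And>e. e > 0 \<Longrightarrow> a \<le> f e"
  shows "a \<le> f 0"
proof -
  have "(\<lambda>n. f (1 / real (Suc n))) \<longlonglongrightarrow> f 0"
    using isCont_tendsto_compose[OF assms(1) LIMSEQ_Suc[OF lim_1_over_n]] by simp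
  then show ?thesis using assms(2) by (intro LIMSEQ_le_const) auto
qed

text \<open>
  Apply Cauchy--Schwarz to \<open>\<parallel>S y\<parallel>\<^sup>2 = inner (T (S y)) y\<close>: an upper bound for \<open>T\<close> at the
  vector \<open>S y\<close> is one for \<open>S\<close> at \<open>y\<close>.
\<close>

lemma adjoint_upper_bound:
  assumes TS: "adjoint_pair T S" and "c \<ge> 0" "(norm (T (S y)))\<^sup>2 \<le> c * (norm (S y))\<^sup>2"
  shows "(norm (S y))\<^sup>2 \<le> c * (norm y)\<^sup>2"
proof (cases "S y = 0")
  case False
  have "((norm (S y))\<^sup>2)\<^sup>2 \<le> (norm (T (S y)) * norm y)\<^sup>2"
    using adjoint_pair_quadratic_form(2)[OF adjoint_pair_sym[OF TS], of y] by (intro power_mono) auto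
  also have "\<dots> \<le> (c * (norm (S y))\<^sup>2) * (norm y)\<^sup>2"
    unfolding power_mult_distrib using assms(3) by (intro mult_right_mono) auto
  finally have "(norm (S y))\<^sup>2 * (norm (S y))\<^sup>2 \<le> (norm (S y))\<^sup>2 * (c * (norm y)\<^sup>2)"
    by (simp add: power2_eq_square algebra_simps)
  then show ?thesis by (rule mult_left_le_imp_le) (use False in simp)
qed (simp add: \<open>c \<ge> 0\<close>)

section \<open>Pinching of products and adjoints\<close>

text \<open>
  In infinite dimension the level \<open>c\<close> is nonnegative, since some nonzero vector satisfies the upper
  bound.
\<close>

lemma pinched_cases:
  fixes T :: "'a::complex_inner \<Rightarrow> 'b::complex_inner"
  assumes "pinched T" "\<And>B::'a set. finite B \<Longrightarrow> \<not> orth B \<subseteq> {0}"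
  obtains c where "c \<ge> 0" "essentially_le T c" "\<And>a. a < c \<Longrightarrow> essentially_ge T a"
proof -
  obtain c where c: "essentially_le T c" "\<And>a. a < c \<Longrightarrow> essentially_ge T a"
    using assms(1) unfolding pinched_def by blast
  obtain B where B: "finite B" "\<And>x. x \<in> orth B \<Longrightarrow> (norm (T x))\<^sup>2 \<le> c * (norm x)\<^sup>2"
    using c(1) unfolding essentially_le_def by blast
  obtain x where x: "x \<in> orth B" "x \<noteq> 0" using assms(2)[OF B(1)] by blast
  have "0 \<le> c * (norm x)\<^sup>2" using B(2)[OF x(1)] zero_le_power2[of "norm (T x)"] by linarith
  then have "c \<ge> 0" using x(2) by (simp add: zero_le_mult_iff)
  then show ?thesis using that c by blast
qed

lemma essentially_ge_mult_adjoint: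
  fixes T :: "'a::complex_inner \<Rightarrow> 'b::complex_inner"
  assumes TS: "adjoint_pair T S" and "essentially_ge T b" "b \<ge> 0"
  shows "essentially_ge (S \<circ> T) (b\<^sup>2)"
proof -
  obtain B where B: "finite B" "\<And>x. x \<in> orth B \<Longrightarrow> b * (norm x)\<^sup>2 \<le> (norm (T x))\<^sup>2"
    using assms(2) unfolding essentially_ge_def by blast
  have "b\<^sup>2 * (norm x)\<^sup>2 \<le> (norm ((S \<circ> T) x))\<^sup>2" if x: "x \<in> orth B" for x
  proof -
    have "norm x * (b * norm x) \<le> norm x * norm (S (T x))"
      using order_trans[OF B(2)[OF x] adjoint_pair_quadratic_form(2)[OF TS]]
      by (simp add: power2_eq_square ac_simps)
    then have "b * norm x \<le> norm (S (T x))" by (cases "x = 0") simp_all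
    then have "(b * norm x)\<^sup>2 \<le> (norm (S (T x)))\<^sup>2" using \<open>b \<ge> 0\<close> by (intro power_mono) auto
    then show ?thesis by (simp add: power_mult_distrib)
  qed
  then show ?thesis unfolding essentially_ge_def using B(1) by blast
qed

text \<open>
  The upper bound of \<open>T\<close> is used at \<open>x\<close> and at \<open>S (T x)\<close>, and so the subspace on which it holds is
  intersected with its preimage under \<open>S \<circ> T\<close>.
\<close>

lemma pinched_mult_adjoint:
  fixes T :: "'a::complex_inner \<Rightarrow> 'b::complex_inner"
  assumes TS: "adjoint_pair T S" and "pinched T"
  shows "pinched (S \<circ> T)"
proof (cases "\<exists>B::'a set. finite B \<and> orth B \<subseteq> {0}")
  case True
  then show ?thesis
    using pinched_finite_dimensional bounded_clinearD(4)[OF adjoint_pairD(1)[OF adjoint_pair_comp[OF TS]]] by blast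
next
  case False
  then obtain c where c: "c \<ge> 0" "essentially_le T c" "\<And>a. a < c \<Longrightarrow> essentially_ge T a"
    using pinched_cases[OF assms(2)] by blast
  obtain B where B: "finite B" "\<And>x. x \<in> orth B \<Longrightarrow> (norm (T x))\<^sup>2 \<le> c * (norm x)\<^sup>2"
    using c(2) unfolding essentially_le_def by blast
  have "(norm ((S \<circ> T) x))\<^sup>2 \<le> c\<^sup>2 * (norm x)\<^sup>2" if "x \<in> orth (B \<union> (S \<circ> T) ` B)" for x
  proof -
    have x: "x \<in> orth B" "S (T x) \<in> orth B"
      using that mem_orth_image[OF adjoint_pair_comp[OF TS], of x B] unfolding orth_Un by auto
    have "(norm (S (T x)))\<^sup>2 \<le> c * (norm (T x))\<^sup>2"
      using adjoint_upper_bound[OF TS c(1) B(2)[OF x(2)]] .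
    also have "\<dots> \<le> c * (c * (norm x)\<^sup>2)" using B(2)[OF x(1)] c(1) by (intro mult_left_mono)
    finally show ?thesis by (simp add: power2_eq_square mult.assoc)
  qed
  then have "essentially_le (S \<circ> T) (c\<^sup>2)"
    unfolding essentially_le_def using B(1) by (intro exI[of _ "B \<union> (S \<circ> T) ` B"]) auto
  moreover have "essentially_ge (S \<circ> T) a" if a: "a < c\<^sup>2" for a
  proof (cases "a \<le> 0")
    case True
    then show ?thesis using essentially_ge_mono[OF essentially_ge_0] by blast
  next
    case False
    then have "sqrt a < c" using real_sqrt_less_mono[OF a] c(1) by simp
    then show ?thesis using essentially_ge_mult_adjoint[OF TS c(3), of "sqrt a"] False by simp
  qed
  ultimately show ?thesis unfolding pinched_def by blast
qed

text \<open>
  The lower bounds are the point at issue, as a lower bound for \<open>\<parallel>S (T x)\<parallel>\<close> on a subspace gives no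
  bound for \<open>\<parallel>T x\<parallel>\<close> on the same subspace with the right constant.  But the Weyl vectors for the
  least point \<open>d\<close> of the essential spectrum of \<open>S \<circ> T\<close> satisfy \<open>\<parallel>S (T x)\<parallel> \<approx> d\<close>, so that
  \<open>c \<le> d\<^sup>2\<close>.
\<close>

lemma pinched_of_mult_adjoint:
  fixes T :: "'a::complex_inner \<Rightarrow> 'b::complex_inner"
  assumes TS: "adjoint_pair T S" and "pinched (S \<circ> T)"
  shows "pinched T"
proof (cases "\<exists>B::'a set. finite B \<and> orth B \<subseteq> {0}")
  case True
  then show ?thesis
    using pinched_finite_dimensional bounded_clinearD(4)[OF adjoint_pairD(1)[OF TS]] by blast
next
  case False
  then obtain c where c: "c \<ge> 0" "essentially_le (S \<circ> T) c" "\<And>a. a < c \<Longrightarrow> essentially_ge (S \<circ> T) a"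
    using pinched_cases[OF assms(2)] by blast
  obtain d where d: "d \<ge> 0" "\<And>a. a < d \<Longrightarrow> essentially_ge T a" "\<And>a. a > d \<Longrightarrow> \<not> essentially_ge T a"
    using essential_bottom[OF adjoint_pairD(1)[OF TS]] False by metis
  obtain B where B: "finite B" "\<And>x. x \<in> orth B \<Longrightarrow> (norm (S (T x)))\<^sup>2 \<le> c * (norm x)\<^sup>2"
    using c(2) unfolding essentially_le_def by auto
  have "(norm (T x))\<^sup>2 \<le> sqrt c * (norm x)\<^sup>2" if "x \<in> orth B" for x
  proof -
    have "norm (S (T x)) \<le> sqrt c * norm x"
      by (rule power2_le_imp_le) (use B(2)[OF that] c(1) in \<open>auto simp: power_mult_distrib\<close>)
    then have "norm (S (T x)) * norm x \<le> sqrt c * norm x * norm x" by (rule mult_right_mono) simp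
    then show ?thesis using adjoint_pair_quadratic_form(2)[OF TS, of x] by (simp add: power2_eq_square mult.assoc)
  qed
  then have "essentially_le T (sqrt c)" unfolding essentially_le_def using B(1) by blast
  moreover have "sqrt c \<le> d"
  proof -
    have "a \<le> d\<^sup>2" if a: "a < c" for a
    proof -
      obtain B where B: "finite B" "\<And>x. x \<in> orth B \<Longrightarrow> a * (norm x)\<^sup>2 \<le> (norm (S (T x)))\<^sup>2"
        using c(3)[OF a] unfolding essentially_ge_def by auto
      have "a \<le> (d + e)\<^sup>2" if e: "e > 0" for e
      proof -
        obtain x where x: "x \<in> orth B" "norm x = 1" "norm (S (T x) - d *\<^sub>R x) \<le> e"
          using weyl_vector[OF TS d(2,3) e B(1)] by blast
        have "norm (S (T x)) \<le> d + e"
          using norm_triangle_sub[of "S (T x)" "d *\<^sub>R x"] x(2,3) d(1) by simp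
        then have "(norm (S (T x)))\<^sup>2 \<le> (d + e)\<^sup>2" by (intro power_mono) auto
        then show ?thesis using B(2)[OF x(1)] x(2) by simp
      qed
      then show ?thesis using limit_le[of "\<lambda>e. (d + e)\<^sup>2" a] by (auto intro!: continuous_intros)
    qed
    then have "c \<le> d\<^sup>2" using dense_le by blast
    then show ?thesis using real_sqrt_le_mono[of c "d\<^sup>2"] d(1) by simp
  qed
  then have "essentially_ge T a" if "a < sqrt c" for a using d(2) that by simp
  ultimately show ?thesis unfolding pinched_def by blast
qed

text \<open>
  If \<open>y\<close> is an approximate eigenvector of \<open>T \<circ> S\<close> for \<open>d > 0\<close>, then \<open>x = S y\<close> is one of \<open>S \<circ> T\<close> for
  \<open>d\<close>, because \<open>\<parallel>S y\<parallel>\<^sup>2 \<approx> d\<close> keeps it away from \<open>0\<close>.  Applied to the least point \<open>d\<close> of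
  the essential spectrum of \<open>T \<circ> S\<close> this gives \<open>c \<le> d\<close>.  The argument breaks down at \<open>d = 0\<close>, and
  the assumption \<open>below\<close> excludes this value when \<open>c > 0\<close>.
\<close>

lemma pinched_adjoint:
  fixes T :: "'a::complex_inner \<Rightarrow> 'a"
  assumes TS: "adjoint_pair T S" and "pinched T"
    and below: "\<And>a. a > 0 \<Longrightarrow> essentially_ge T a \<Longrightarrow> \<exists>b>0. essentially_ge S b"
  shows "pinched S"
proof (cases "\<exists>B::'a set. finite B \<and> orth B \<subseteq> {0}")
  case True
  then show ?thesis
    using pinched_finite_dimensional bounded_clinearD(4)[OF adjoint_pairD(2)[OF TS]] by blast
next
  case False
  note ST = adjoint_pair_sym[OF TS]
  obtain c where c: "c \<ge> 0" "essentially_le T c" "\<And>a. a < c \<Longrightarrow> essentially_ge T a"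
    using False pinched_cases[OF assms(2)] by blast
  obtain d where d: "d \<ge> 0" "\<And>a. a < d \<Longrightarrow> essentially_ge S a" "\<And>a. a > d \<Longrightarrow> \<not> essentially_ge S a"
    using essential_bottom[OF adjoint_pairD(2)[OF TS]] False by metis
  obtain B where B: "finite B" "\<And>x. x \<in> orth B \<Longrightarrow> (norm (T x))\<^sup>2 \<le> c * (norm x)\<^sup>2"
    using c(2) unfolding essentially_le_def by blast
  have "(norm (S y))\<^sup>2 \<le> c * (norm y)\<^sup>2" if "y \<in> orth (T ` B)" for y
    using adjoint_upper_bound[OF TS c(1) B(2)] that mem_orth_image[OF ST] by blast
  then have "essentially_le S c" unfolding essentially_le_def using B(1) by blast
  moreover have "c \<le> d"
  proof (cases "c = 0")
    case False
    then have "c / 2 > 0" "c / 2 < c" using c(1) by auto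
    then obtain b where b: "b > 0" "essentially_ge S b" using below c(3) by blast
    have "d > 0" using d(3)[of b] b by (meson not_le order_less_le_trans)
    have "a \<le> d" if a: "a < c" for a
    proof (cases "a \<le> 0")
      case False
      obtain B where B: "finite B" "\<And>x. x \<in> orth B \<Longrightarrow> a * (norm x)\<^sup>2 \<le> (norm (T x))\<^sup>2"
        using c(3)[OF a] unfolding essentially_ge_def by auto
      have "0 \<le> (d + e)\<^sup>2 - a * (d - e)" if e: "e > 0" for e
      proof -
        obtain y where y: "y \<in> orth (T ` B)" "norm y = 1" "norm (T (S y) - d *\<^sub>R y) \<le> e"
          using weyl_vector[OF ST d(2,3) e, where B = "T ` B"] B(1) by blast
        have Sy: "S y \<in> orth B" using mem_orth_image[OF ST] y(1) by blast
        have "inner (T (S y) - d *\<^sub>R y) y = (norm (S y))\<^sup>2 - d"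
          using y(2) by (simp add: inner_diff_left adjoint_pair_quadratic_form(1)[OF ST]
              power2_norm_eq_inner[symmetric])
        moreover have "\<bar>inner (T (S y) - d *\<^sub>R y) y\<bar> \<le> e"
          using Cauchy_Schwarz_ineq2[of "T (S y) - d *\<^sub>R y" y] y(2,3) by simp
        ultimately have "d - e \<le> (norm (S y))\<^sup>2" by linarith
        then have "a * (d - e) \<le> a * (norm (S y))\<^sup>2" using False by (intro mult_left_mono) auto
        also have "\<dots> \<le> (norm (T (S y)))\<^sup>2" using B(2)[OF Sy] .
        also have "\<dots> \<le> (d + e)\<^sup>2"
          using norm_triangle_sub[of "T (S y)" "d *\<^sub>R y"] y(2,3) d(1) by (intro power_mono) auto
        finally show ?thesis by simp
      qed
      then have "0 \<le> (d + 0)\<^sup>2 - a * (d - 0)"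
        by (intro limit_le[of "\<lambda>e. (d + e)\<^sup>2 - a * (d - e)" 0]) (auto intro!: continuous_intros)
      then have "d * a \<le> d * d" by (simp add: power2_eq_square mult.commute)
      then show ?thesis using \<open>d > 0\<close> by simp
    qed (use d(1) in simp)
    then show ?thesis using dense_le by blast
  qed (use d(1) in simp)
  then have "essentially_ge S a" if "a < c" for a using d(2) that by simp
  ultimately show ?thesis unfolding pinched_def by blast
qed

section \<open>The point zero and the essential spectrum\<close>

lemma adjoint_pair_shift:
  fixes A :: "'a::complex_inner \<Rightarrow> 'a"
  assumes "adjoint_pair A A"
  shows "adjoint_pair (\<lambda>x. A x - l *\<^sub>C x) (\<lambda>x. A x - cnj l *\<^sub>C x)"
proof -
  note Al = bounded_clinearD[OF adjoint_pairD(1)[OF assms]]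
  have "bounded_clinear (\<lambda>x. A x - k *\<^sub>C x)" for k
    unfolding bounded_clinear_def
  proof (intro conjI allI)
    show "bounded_linear (\<lambda>x. A x - k *\<^sub>C x)"
      by (intro bounded_linear_sub Al(1) bounded_linear_scaleC)
    show "A (c *\<^sub>C x) - k *\<^sub>C c *\<^sub>C x = c *\<^sub>C (A x - k *\<^sub>C x)" for c x
      unfolding Al(5) complex_vector.scale_right_diff_distrib scaleC_scaleC mult.commute[of k] ..
  qed
  then show ?thesis unfolding adjoint_pair_def
    by (simp add: cinner_diff_left cinner_diff_right cinner_scaleC_left cinner_scaleC_right
        adjoint_pairD(3)[OF assms])
qed

text \<open>
  Boundedness from below makes \<open>R\<close> injective with closed range, and the injectivity of its adjoint makes
  the range dense.
\<close>

lemma invertible_if_bounded_below: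
  fixes R :: "'a::chilbert_space \<Rightarrow> 'a"
  assumes RS: "adjoint_pair R R'" and "d > 0"
    and below: "\<And>x. d * norm x \<le> norm (R x)" and inj': "\<And>y. R' y = 0 \<Longrightarrow> y = 0"
  shows "\<exists>S. bounded_clinear S \<and> R \<circ> S = id \<and> S \<circ> R = id"
proof -
  note Rl = bounded_clinearD[OF adjoint_pairD(1)[OF RS]]
  have "inj R"
  proof (rule injI)
    fix x y assume "R x = R y"
    then have "R (x - y) = 0" by (simp add: Rl)
    then have "d * norm (x - y) \<le> 0" using below[of "x - y"] by simp
    then show "x = y" using \<open>d > 0\<close> by (simp add: mult_le_0_iff)
  qed
  have "complete (range R)"
    using \<open>d > 0\<close> below by (intro complete_isometric_image[where e = d]) (auto intro: Rl(1) complete_UNIV simp: mult.commute)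
  then have "closed (range R)" by (rule complete_imp_closed)
  have sub: "csubspace (range R)"
    unfolding complex_vector.subspace_def
  proof (intro conjI ballI allI)
    show "0 \<in> range R" using Rl(4) by (metis rangeI)
    show "x + y \<in> range R" if "x \<in> range R" "y \<in> range R" for x y
      using that by (auto simp: Rl(2)[symmetric])
    show "c *\<^sub>C x \<in> range R" if "x \<in> range R" for c x
      using that by (auto simp: Rl(5)[symmetric])
  qed
  have "y \<in> range R" for y
  proof -
    obtain p where p: "p \<in> range R" "\<And>m. m \<in> range R \<Longrightarrow> cinner m (y - p) = 0"
      using csubspace_projection[OF \<open>closed (range R)\<close> sub] by blast
    have "cinner x (R' (y - p)) = 0" for x
      using p(2)[OF rangeI, of x] unfolding adjoint_pairD(3)[OF RS, of x] .
    then have "R' (y - p) = 0" using cinner_eqI[of "R' (y - p)" 0] by simp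
    then have "y = p" using inj'[of "y - p"] by simp
    then show ?thesis using p(1) by simp
  qed
  then have "surj R" by blast
  have inv: "R (inv R y) = y" for y using surj_f_inv_f[OF \<open>surj R\<close>] .
  have "bounded_clinear (inv R)"
    unfolding bounded_clinear_def
  proof (intro conjI allI bounded_linear_intro[where K = "1 / d"])
    show "inv R (x + y) = inv R x + inv R y" for x y
      by (rule injD[OF \<open>inj R\<close>]) (simp add: inv Rl)
    show "inv R (r *\<^sub>R x) = r *\<^sub>R inv R x" for r x
      by (rule injD[OF \<open>inj R\<close>]) (simp add: inv Rl)
    show "inv R (c *\<^sub>C x) = c *\<^sub>C inv R x" for c x
      by (rule injD[OF \<open>inj R\<close>]) (simp add: inv Rl)
    show "norm (inv R x) \<le> norm x * (1 / d)" for x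
      using below[of "inv R x"] \<open>d > 0\<close> by (simp add: inv field_simps)
  qed
  then show ?thesis using inv inv_f_f[OF \<open>inj R\<close>] by (intro exI[of _ "inv R"]) auto
qed

lemma notin_spectrum_if_bounded_below:
  fixes A :: "'a::chilbert_space \<Rightarrow> 'a"
  assumes "adjoint_pair A A" "d > 0"
    and "\<And>x. d * norm x \<le> norm (A x - l *\<^sub>C x)" "\<And>x. d * norm x \<le> norm (A x - cnj l *\<^sub>C x)"
  shows "l \<notin> spectrum A"
proof -
  have "y = 0" if "A y - cnj l *\<^sub>C y = 0" for y
    using assms(4)[of y] that \<open>d > 0\<close> by (simp add: mult_le_0_iff)
  then show ?thesis
    using invertible_if_bounded_below[OF adjoint_pair_shift[OF assms(1)] assms(2,3)]
    unfolding spectrum_def by blast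
qed

lemma bounded_below_if_notin_spectrum:
  fixes A :: "'a::complex_inner \<Rightarrow> 'a"
  assumes "l \<notin> spectrum A"
  obtains d where "d > 0" "\<And>x. d * norm x \<le> norm (A x - l *\<^sub>C x)"
proof -
  obtain S where S: "bounded_clinear S" "S \<circ> (\<lambda>x. A x - l *\<^sub>C x) = id"
    using assms unfolding spectrum_def by blast
  obtain K where K: "K > 0" "\<And>x. norm (S x) \<le> K * norm x" using bounded_clinear_bound[OF S(1)] by blast
  have "(1 / K) * norm x \<le> norm (A x - l *\<^sub>C x)" for x
  proof -
    have "x = S (A x - l *\<^sub>C x)" using fun_cong[OF S(2), of x] by simp
    then have "norm x \<le> K * norm (A x - l *\<^sub>C x)" using K(2)[of "A x - l *\<^sub>C x"] by simp
    then show ?thesis using K(1) by (simp add: field_simps)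
  qed
  then show ?thesis using that[of "1 / K"] K(1) by simp
qed

lemma kernel_mult_adjoint:
  assumes "adjoint_pair T S"
  shows "S (T x) = 0 \<longleftrightarrow> T x = 0"
  using adjoint_pair_quadratic_form(2)[OF assms, of x] bounded_clinearD(4)[OF adjoint_pairD(2)[OF assms]]
  by auto

text \<open>
  The kernel \<open>N\<close> of \<open>T\<close>, which is that of \<open>A = S \<circ> T\<close>, meets a subspace of finite codimension only in
  \<open>0\<close>, hence has finite dimension.  On its orthogonal complement \<open>M\<close> the minimum modulus of \<open>T\<close> is
  attained because there is a gap above \<open>0\<close>, so it is positive.  As \<open>A\<close> respects the decomposition into \<open>N\<close>
  and \<open>M\<close>, vanishes on \<open>N\<close> and is bounded below on \<open>M\<close>, the operator \<open>A - l\<close> is invertible for all small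
  \<open>l \<noteq> 0\<close>.  Thus \<open>0\<close> is either outside the spectrum or an isolated eigenvalue of finite multiplicity.
\<close>

lemma zero_notin_essential_spectrum:
  fixes T :: "'a::chilbert_space \<Rightarrow> 'b::complex_inner"
  assumes TS: "adjoint_pair T S" and "essentially_ge T a" "a > 0"
  shows "0 \<notin> essential_spectrum (S \<circ> T)"
proof
  assume "0 \<in> essential_spectrum (S \<circ> T)"
  define A where "A = S \<circ> T"
  have ess: "0 \<in> spectrum A" "0 \<notin> discrete_spectrum A"
    using \<open>0 \<in> essential_spectrum (S \<circ> T)\<close> unfolding essential_spectrum_def A_def by auto
  have AA: "adjoint_pair A A" unfolding A_def using adjoint_pair_comp[OF TS] .
  note T = adjoint_pairD(1)[OF TS]
  note Tl = bounded_clinearD[OF T] and Al = bounded_clinearD[OF adjoint_pairD(1)[OF AA]]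
  obtain B where B: "finite B" "\<And>x. x \<in> orth B \<Longrightarrow> a * (norm x)\<^sup>2 \<le> (norm (T x))\<^sup>2"
    using assms(2) unfolding essentially_ge_def by blast
  define N where "N = {x. T x = 0}"
  have N: "csubspace N" unfolding N_def complex_vector.subspace_def by (auto simp: Tl)
  have Ncl: "closed N" unfolding N_def
    by (intro closed_Collect_eq continuous_on_const linear_continuous_on Tl(1))
  have eig: "eigenspace A 0 = N"
    unfolding eigenspace_def N_def A_def using kernel_mult_adjoint[OF TS] by auto
  have AN: "A n = 0" if "n \<in> N" for n using that bounded_clinearD(4)[OF adjoint_pairD(2)[OF TS]] unfolding N_def A_def by simp
  define M where "M = orth N"
  have M: "csubspace M" "closed M" unfolding M_def by (rule csubspace_orth closed_orth)+
  have NM: "n = 0" if "n \<in> N" "n \<in> M" for n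
    using that cinner_self[of n] unfolding M_def orth_def by auto
  have "\<exists>d>0. \<forall>x\<in>M. d * norm x \<le> norm (T x)"
  proof (cases "M = {0}")
    case True then show ?thesis by (intro exI[of _ 1]) simp
  next
    case False
    define m where "m = minimum_modulus_on M T"
    obtain y where "y \<in> M" "y \<noteq> 0" using False complex_vector.subspace_0[OF M(1)] by auto
    then obtain y where "y \<in> M" "norm y = 1" using unit_vector_in_csubspace[OF M(1)] by metis
    then have m0: "m \<ge> 0" unfolding m_def by (rule minimum_modulus_on_nonneg)
    have "m \<noteq> 0"
    proof
      assume m: "m = 0"
      have "minimum_attaining_on M T"
        by (rule minimum_attained_if_gap[OF T M False B(1), of a])
          (use B(2) \<open>a > 0\<close> m in \<open>auto simp: m_def\<close>)
      then obtain x where x: "x \<in> M" "norm x = 1" "norm (T x) = 0"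
        using m unfolding minimum_attaining_on_def m_def by auto
      then have "x = 0" using NM unfolding N_def by simp
      then show False using x(2) by simp
    qed
    then show ?thesis
      using m0 minimum_modulus_on_bound[OF M(1) _ T] unfolding m_def by (intro exI[of _ m]) (auto simp: m_def)
  qed
  then obtain d0 where d0: "d0 > 0" "\<And>x. x \<in> M \<Longrightarrow> d0 * norm x \<le> norm (T x)" by blast
  define d where "d = d0\<^sup>2"
  have d: "d > 0" unfolding d_def using d0(1) by simp
  have AM_below: "d * norm x \<le> norm (A x)" if "x \<in> M" for x
  proof -
    have "(d0 * norm x)\<^sup>2 \<le> (norm (T x))\<^sup>2" using d0(1) d0(2)[OF that] by (intro power_mono) auto
    also have "\<dots> \<le> norm (A x) * norm x" using adjoint_pair_quadratic_form(2)[OF TS] by (simp add: A_def)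
    finally have "norm x * (d * norm x) \<le> norm x * norm (A x)"
      by (simp add: d_def power_mult_distrib power2_eq_square ac_simps)
    then show ?thesis by (cases "x = 0") simp_all
  qed
  have AM_in: "A x \<in> M" for x
    unfolding M_def orth_def using AN adjoint_pairD(3)[OF AA, symmetric] by simp
  have below: "cmod l * norm x \<le> norm (A x - l *\<^sub>C x)" if "cmod l \<le> d / 2" for l x
  proof -
    obtain u where u: "u \<in> N" "\<And>m. m \<in> N \<Longrightarrow> cinner m (x - u) = 0"
      using csubspace_projection[OF Ncl N] by blast
    define v where "v = x - u"
    have v: "v \<in> M" "x = u + v" using u unfolding v_def M_def orth_def by auto
    define w where "w = A v - l *\<^sub>C v"
    have wM: "w \<in> M" unfolding w_def using AM_in v M
      by (auto intro!: complex_vector.subspace_diff complex_vector.subspace_scale)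
    have Axw: "A x - l *\<^sub>C x = (- l) *\<^sub>C u + w"
      unfolding w_def v(2) Al(2) by (simp add: AN[OF u(1)] scaleC_add_right algebra_simps)
    have ort: "orthogonal u v" "orthogonal ((- l) *\<^sub>C u) w"
      using u(1) v(1) wM unfolding M_def orth_def orthogonal_def inner_eq_Re_cinner
      by (simp_all add: cinner_scaleC_left del: complex_vector.scale_minus_left)
    have "cmod l * norm v \<le> d * norm v - cmod l * norm v"
      using mult_right_mono[OF that, of "norm v"] by (simp add: algebra_simps)
    also have "\<dots> \<le> norm (A v) - norm (l *\<^sub>C v)" using AM_below[OF v(1)] by (simp add: norm_scaleC)
    also have "\<dots> \<le> norm w" unfolding w_def by (rule norm_triangle_ineq2)
    finally have "(cmod l * norm v)\<^sup>2 \<le> (norm w)\<^sup>2" by (intro power_mono) auto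
    moreover have "(norm x)\<^sup>2 = (norm u)\<^sup>2 + (norm v)\<^sup>2"
      unfolding v(2) by (rule norm_add_Pythagorean[OF ort(1)])
    moreover have "(norm (A x - l *\<^sub>C x))\<^sup>2 = (cmod l)\<^sup>2 * (norm u)\<^sup>2 + (norm w)\<^sup>2"
      unfolding Axw norm_add_Pythagorean[OF ort(2)] by (simp add: norm_scaleC power_mult_distrib)
    ultimately have "(cmod l * norm x)\<^sup>2 \<le> (norm (A x - l *\<^sub>C x))\<^sup>2"
      by (simp add: power_mult_distrib distrib_left)
    then show ?thesis by (rule power2_le_imp_le) simp
  qed
  have notin: "l \<notin> spectrum A" if "cmod l \<le> d / 2" "l \<noteq> 0" for l
    using that below[of l] below[of "cnj l"]
    by (intro notin_spectrum_if_bounded_below[OF AA, of "cmod l"]) auto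
  have "N \<noteq> {0}"
  proof
    assume "N = {0}"
    then have "M = UNIV" unfolding M_def orth_def by simp
    then have "0 \<notin> spectrum A"
      using AM_below by (intro notin_spectrum_if_bounded_below[OF AA d]) auto
    then show False using ess(1) by blast
  qed
  moreover have "\<exists>D. finite D \<and> cspan D = N"
  proof (rule finite_dimensional_if_orth_trivial[OF B(1) N])
    show "N \<inter> orth B \<subseteq> {0}"
      using B(2) \<open>a > 0\<close> unfolding N_def by (auto simp: mult_le_0_iff dest!: B(2))
  qed
  moreover have "0 isolated_in spectrum A"
    unfolding isolated_in_def
  proof (intro conjI exI)
    show "open (ball (0::complex) (d / 2))" by simp
    show "ball 0 (d / 2) \<inter> spectrum A = {0}" using notin d ess(1) by force
  qed (rule ess(1))
  ultimately show False
    using ess(2) unfolding discrete_spectrum_def eigenvalue_of_finite_multiplicity_def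
    by (simp add: eig)
qed

text \<open>
  For the self-adjoint operator \<open>C = A - k\<close> with minimum modulus \<open>m\<close>, the gradient bound yields
  approximate eigenvectors of \<open>C\<^sup>2\<close> for \<open>m\<^sup>2\<close>.  Since
  \<open>C\<^sup>2 - m\<^sup>2 = (C - m) (C + m)\<close>, one of the real numbers \<open>k \<plusminus> m\<close> belongs to the spectrum of \<open>A\<close>,
  so \<open>m\<close> is at least the radius \<open>r\<close> of the gap around \<open>k\<close>.
\<close>

lemma spectral_gap_bound:
  fixes A :: "'a::complex_inner \<Rightarrow> 'a"
  assumes AA: "adjoint_pair A A" and "r > 0" and nontriv: "(UNIV :: 'a set) \<noteq> {0}"
    and gap: "\<And>l. \<bar>l - k\<bar> < r \<Longrightarrow> complex_of_real l \<notin> spectrum A"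
  shows "r * norm x \<le> norm (A x - k *\<^sub>R x)"
proof -
  define C where "C x = A x - k *\<^sub>R x" for x
  have CC: "adjoint_pair C C"
    using adjoint_pair_shift[OF AA, of "complex_of_real k"] unfolding C_def scaleR_scaleC by simp
  note C = adjoint_pairD(1)[OF CC]
  note Cl = bounded_clinearD[OF C]
  have U: "csubspace (UNIV :: 'a set)" by simp
  define m where "m = minimum_modulus_on UNIV C"
  obtain x0 where x0: "\<And>n. norm (x0 n) = 1" "(\<lambda>n. norm (C (x0 n))) \<longlonglongrightarrow> m"
    using minimum_modulus_on_sequence[OF U nontriv, of C] unfolding m_def by metis
  have m0: "m \<ge> 0" unfolding m_def using minimum_modulus_on_nonneg[OF UNIV_I x0(1)] .
  have low: "m * norm x \<le> norm (C x)" for x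
    using minimum_modulus_on_bound[OF U UNIV_I C] unfolding m_def .
  have "r \<le> m"
  proof (rule ccontr)
    assume "\<not> r \<le> m"
    then have "\<bar>(k + m) - k\<bar> < r" "\<bar>(k - m) - k\<bar> < r" using m0 by auto
    then obtain d1 d2 where d1: "d1 > 0" "\<And>x. d1 * norm x \<le> norm (A x - complex_of_real (k + m) *\<^sub>C x)"
      and d2: "d2 > 0" "\<And>x. d2 * norm x \<le> norm (A x - complex_of_real (k - m) *\<^sub>C x)"
      using bounded_below_if_notin_spectrum gap by metis
    have low1: "d1 * norm x \<le> norm (C x - m *\<^sub>R x)" for x
      using d1(2)[of x] unfolding C_def scaleR_scaleC[symmetric] by (simp add: algebra_simps)
    have low2: "d2 * norm x \<le> norm (C x + m *\<^sub>R x)" for x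
      using d2(2)[of x] unfolding C_def scaleR_scaleC[symmetric] by (simp add: algebra_simps)
    obtain K0 where K0: "K0 > 0" "\<And>x. norm (C x) \<le> K0 * norm x" using bounded_clinear_bound[OF C] by blast
    have le: "(d1 * d2)\<^sup>2 \<le> K0\<^sup>2 * ((norm (C (x0 n)))\<^sup>2 - m\<^sup>2)" for n
    proof -
      define x where "x = x0 n"
      define z where "z = C (C x) - m\<^sup>2 *\<^sub>R x"
      have "z = C (C x + m *\<^sub>R x) - m *\<^sub>R (C x + m *\<^sub>R x)"
        unfolding z_def by (simp add: Cl scaleR_add_right power2_eq_square)
      then have "d1 * norm (C x + m *\<^sub>R x) \<le> norm z" using low1 by metis
      moreover have "d1 * (d2 * norm x) \<le> d1 * norm (C x + m *\<^sub>R x)"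
        using low2 d1(1) by (intro mult_left_mono) auto
      ultimately have "d1 * d2 \<le> norm z" using x0(1) by (simp add: x_def)
      then have "(d1 * d2)\<^sup>2 \<le> (norm z)\<^sup>2" using d1(1) d2(1) by (intro power_mono) auto
      also have "\<dots> \<le> K0\<^sup>2 * ((norm (C x))\<^sup>2 - m\<^sup>2 * (norm x)\<^sup>2)"
      proof (rule gradient_bound[OF CC _ z_def])
        show "K0\<^sup>2 > 0" using K0(1) by simp
        show "(norm (C z))\<^sup>2 - m\<^sup>2 * (norm z)\<^sup>2 \<le> K0\<^sup>2 * (norm z)\<^sup>2"
          using power_mono[OF K0(2)[of z] norm_ge_zero, of 2]
            mult_nonneg_nonneg[OF zero_le_power2[of m] zero_le_power2[of "norm z"]]
          unfolding power_mult_distrib by linarith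
        show "m\<^sup>2 * (norm (x - (1 / K0\<^sup>2) *\<^sub>R z))\<^sup>2 \<le> (norm (C (x - (1 / K0\<^sup>2) *\<^sub>R z)))\<^sup>2"
          unfolding power_mult_distrib[symmetric] using low m0 by (intro power_mono) auto
      qed
      finally show ?thesis using x0(1)[of n] by (simp add: x_def)
    qed
    have "(\<lambda>n. K0\<^sup>2 * ((norm (C (x0 n)))\<^sup>2 - m\<^sup>2)) \<longlonglongrightarrow> K0\<^sup>2 * (m\<^sup>2 - m\<^sup>2)"
      by (intro tendsto_intros x0(2))
    then have "(d1 * d2)\<^sup>2 \<le> K0\<^sup>2 * (m\<^sup>2 - m\<^sup>2)" using le by (intro LIMSEQ_le_const) auto
    then show False using d1(1) d2(1) by simp
  qed
  then have "r * norm x \<le> m * norm x" by (rule mult_right_mono) simp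
  then show ?thesis using low[of x] unfolding C_def by simp
qed

text \<open>
  If \<open>0\<close> is isolated in the spectrum of the nonnegative operator \<open>A = S \<circ> T\<close>, then the spectral gap
  \<open>(0, h)\<close> gives \<open>\<parallel>A x - (h/2) x\<parallel> \<ge> (h/2) \<parallel>x\<parallel>\<close>, that is
  \<open>\<parallel>A x\<parallel>\<^sup>2 \<ge> h \<parallel>T x\<parallel>\<^sup>2\<close> after squaring.  Cauchy--Schwarz turns this into
  the lower bound \<open>h\<close> for \<open>T\<close> on the range of \<open>A\<close>, hence on its closure, which is the orthogonal
  complement of the kernel of \<open>A\<close> and so has finite codimension.
\<close>

lemma essentially_ge_if_zero_notin_essential_spectrum:
  fixes T :: "'a::chilbert_space \<Rightarrow> 'b::complex_inner"
  assumes TS: "adjoint_pair T S" and notin: "0 \<notin> essential_spectrum (S \<circ> T)"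
  shows "\<exists>b>0. essentially_ge T b"
proof -
  define A where "A = S \<circ> T"
  have AA: "adjoint_pair A A" unfolding A_def using adjoint_pair_comp[OF TS] .
  note T = adjoint_pairD(1)[OF TS]
  note Al = bounded_clinearD[OF adjoint_pairD(1)[OF AA]]
  show ?thesis
  proof (cases "0 \<in> spectrum A")
    case False
    obtain d where d: "d > 0" "\<And>x. d * norm x \<le> norm (A x - 0 *\<^sub>C x)"
      using bounded_below_if_notin_spectrum[OF False] by blast
    obtain K where K: "K > 0" "\<And>x. norm (S x) \<le> K * norm x"
      using bounded_clinear_bound[OF adjoint_pairD(2)[OF TS]] by blast
    have "(d / K)\<^sup>2 * (norm x)\<^sup>2 \<le> (norm (T x))\<^sup>2" for x
    proof -
      have "d * norm x \<le> K * norm (T x)" using d(2)[of x] K(2)[of "T x"] by (simp add: A_def)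
      then have "d / K * norm x \<le> norm (T x)" using K(1) by (simp add: field_simps)
      then show ?thesis
        unfolding power_mult_distrib[symmetric] using d(1) K(1) by (intro power_mono) auto
    qed
    then show ?thesis
      unfolding essentially_ge_def using d(1) K(1)
      by (intro exI[of _ "(d / K)\<^sup>2"] conjI exI[of _ "{}"]) auto
  next
    case True
    then have disc: "0 isolated_in spectrum A" "eigenvalue_of_finite_multiplicity A 0"
      using notin unfolding essential_spectrum_def discrete_spectrum_def A_def by auto
    obtain D where D: "finite D" "cspan D = eigenspace A 0"
      using disc(2) unfolding eigenvalue_of_finite_multiplicity_def by blast
    have "(UNIV :: 'a set) \<noteq> {0}"
      using disc(2) unfolding eigenvalue_of_finite_multiplicity_def eigenspace_def by (auto simp: Al)
    obtain U where U: "open U" "U \<inter> spectrum A = {0}"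
      using disc(1) unfolding isolated_in_def by blast
    then obtain h where h: "h > 0" "ball 0 h \<subseteq> U" using openE by blast
    have gap: "(h / 2) * norm x \<le> norm (A x - (h / 2) *\<^sub>R x)" for x
    proof (rule spectral_gap_bound[OF AA _ \<open>UNIV \<noteq> {0}\<close>])
      fix l assume "\<bar>l - h / 2\<bar> < h / 2"
      then have "l > 0" "l < h" unfolding abs_less_iff by (simp_all add: field_simps)
      then have "complex_of_real l \<in> U" "complex_of_real l \<noteq> 0" using h(2) by auto
      then show "complex_of_real l \<notin> spectrum A" using U(2) by blast
    qed (use h(1) in simp)
    have STx: "h * (norm (T x))\<^sup>2 \<le> (norm (S (T x)))\<^sup>2" for x
    proof -
      have "((h / 2) * norm x)\<^sup>2 \<le> (norm (A x - (h / 2) *\<^sub>R x))\<^sup>2"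
        using gap h(1) by (intro power_mono) auto
      also have "\<dots> = (norm (A x))\<^sup>2 - h * inner (A x) x + ((h / 2) * norm x)\<^sup>2"
        unfolding power_mult_distrib power2_norm_eq_inner
        by (simp add: algebra_simps inner_commute power2_eq_square)
      also have "inner (A x) x = (norm (T x))\<^sup>2"
        unfolding A_def comp_def adjoint_pair_quadratic_form(1)[OF TS] power2_norm_eq_inner ..
      finally show ?thesis by (simp add: A_def)
    qed
    have ran: "h * (norm (A x))\<^sup>2 \<le> (norm (T (A x)))\<^sup>2" for x
    proof (cases "A x = 0")
      case False
      have "((norm (A x))\<^sup>2)\<^sup>2 \<le> (norm (T (A x)) * norm (T x))\<^sup>2"
        using adjoint_pair_quadratic_form(2)[OF adjoint_pair_sym[OF TS], of "T x"]
        by (intro power_mono) (auto simp: A_def)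
      then have "h * ((norm (A x))\<^sup>2)\<^sup>2 \<le> h * ((norm (T (A x)))\<^sup>2 * (norm (T x))\<^sup>2)"
        using h(1) by (simp add: power_mult_distrib)
      also have "\<dots> = (norm (T (A x)))\<^sup>2 * (h * (norm (T x))\<^sup>2)" by simp
      also have "\<dots> \<le> (norm (T (A x)))\<^sup>2 * (norm (A x))\<^sup>2"
        using STx[of x] by (intro mult_left_mono) (auto simp: A_def)
      finally have "(norm (A x))\<^sup>2 * (h * (norm (A x))\<^sup>2) \<le> (norm (A x))\<^sup>2 * (norm (T (A x)))\<^sup>2"
        by (simp add: power2_eq_square ac_simps)
      then show ?thesis by (rule mult_left_le_imp_le) (use False in simp)
    qed simp
    define P where "P = closure (range A)"
    have "csubspace (range A)"
      unfolding complex_vector.subspace_def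
    proof (intro conjI ballI allI)
      show "0 \<in> range A" using Al(4) by (metis rangeI)
      show "x + y \<in> range A" if "x \<in> range A" "y \<in> range A" for x y
        using that by (auto simp: Al(2)[symmetric])
      show "c *\<^sub>C x \<in> range A" if "x \<in> range A" for c x
        using that by (auto simp: Al(5)[symmetric])
    qed
    then have P: "closed P" "csubspace P" unfolding P_def by (auto intro: csubspace_closure)
    have "closed {z. h * (norm z)\<^sup>2 \<le> (norm (T z))\<^sup>2}"
      by (intro closed_Collect_le continuous_intros linear_continuous_on[OF bounded_clinearD(1)[OF T]])
    then have P_below: "P \<subseteq> {z. h * (norm z)\<^sup>2 \<le> (norm (T z))\<^sup>2}"
      unfolding P_def using ran by (intro closure_minimal) auto
    have "orth D \<subseteq> P"
    proof
      fix x assume "x \<in> orth D"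
      then have "D \<subseteq> orth {x}" using cinner_eq_0_commute unfolding orth_def by blast
      then have "cspan D \<subseteq> orth {x}" by (rule complex_vector.span_minimal) (rule csubspace_orth)
      then have ker: "cinner x r = 0" if "A r = 0" for r
        using that unfolding D(2) eigenspace_def orth_def by auto
      obtain p where p: "p \<in> P" "\<And>m. m \<in> P \<Longrightarrow> cinner m (x - p) = 0"
        using csubspace_projection[OF P] by blast
      have "cinner w (A (x - p)) = 0" for w
    proof -
        have "A w \<in> P" using closure_subset[of "range A"] unfolding P_def by blast
        then show ?thesis using p(2)[of "A w"] unfolding adjoint_pairD(3)[OF AA, of w] by simp
      qed
      then have "A (x - p) = 0" using cinner_eqI[of "A (x - p)" 0] by simp
      then have "cinner x (x - p) = 0" by (rule ker)
      moreover have "cinner p (x - p) = 0" using p by blast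
      ultimately have "cinner (x - p) (x - p) = 0" by (simp only: cinner_diff_left) simp
      then have "x = p" by (simp add: cinner_self)
      then show "x \<in> P" using p(1) by simp
    qed
    then have "essentially_ge T h" unfolding essentially_ge_def using D(1) P_below by blast
    then show ?thesis using h(1) by blast
  qed
qed

section \<open>Absolutely minimum attaining operators and their adjoints\<close>

theorem theorem3p12:
  fixes T :: "'a::chilbert_space \<Rightarrow> 'a"
  assumes "bounded_clinear T"
    and "essential_spectrum (cadjoint T \<circ> T) = essential_spectrum (T \<circ> cadjoint T)"
  shows "(absolutely_minimum_attaining (T \<circ> cadjoint T) \<longleftrightarrow>
            absolutely_minimum_attaining (cadjoint T \<circ> T)) \<and>
         (absolutely_minimum_attaining T \<longleftrightarrow> absolutely_minimum_attaining (cadjoint T))"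
proof -
  define S where "S = cadjoint T"
  have TS: "adjoint_pair T S" unfolding S_def by (rule adjoint_pair_cadjoint[OF assms(1)])
  note ST = adjoint_pair_sym[OF TS]
  have ess: "essential_spectrum (S \<circ> T) = essential_spectrum (T \<circ> S)"
    using assms(2) unfolding S_def .
  have AM_iff: "absolutely_minimum_attaining R \<longleftrightarrow> pinched R" if "adjoint_pair R R'" for R R' :: "'a \<Rightarrow> 'a"
    using pinched_imp_absolutely_minimum_attaining[OF adjoint_pairD(1)[OF that]]
      absolutely_minimum_attaining_imp_pinched[OF _ that] by blast
  have prod_iff: "pinched (R' \<circ> R) \<longleftrightarrow> pinched R" if "adjoint_pair R R'" for R R' :: "'a \<Rightarrow> 'a"
    using pinched_mult_adjoint[OF that] pinched_of_mult_adjoint[OF that] by blast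
  have "pinched T \<longleftrightarrow> pinched S"
  proof
    assume "pinched T"
    then show "pinched S"
      \<comment> \<open>The common essential spectrum carries the information at \<open>0\<close> from \<open>S \<circ> T\<close> to \<open>T \<circ> S\<close>.\<close>
      using zero_notin_essential_spectrum[OF TS]
        essentially_ge_if_zero_notin_essential_spectrum[OF ST] ess
      by (intro pinched_adjoint[OF TS]) auto
  next
    assume "pinched S"
    then show "pinched T"
      using zero_notin_essential_spectrum[OF ST]
        essentially_ge_if_zero_notin_essential_spectrum[OF TS] ess
      by (intro pinched_adjoint[OF ST]) auto
  qed
  then show ?thesis
    unfolding S_def[symmetric]
    using AM_iff[OF TS] AM_iff[OF ST] AM_iff[OF adjoint_pair_comp[OF TS]]
      AM_iff[OF adjoint_pair_comp[OF ST]] prod_iff[OF TS] prod_iff[OF ST] by blast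
qed

end
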